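(* Let $(V,b,c,m)$ be a (connected, locally finite) weighted graph. Then $(V,b,c,m)$ is weakly spherically symmetric if and only if its heat kernel is spherically symmetric.
   Context: A weighted graph $(V,b,c,m)$ consists of a countably infinite set $V$, a map $m:V\to(0,\infty)$ (extended to a measure by $m(U)=\sum_{x\in U}m(x)$), a symmetric map $b:V\times V\to[0,\infty)$ with zero diagonal, and a map $c:V\to[0,\infty)$. Write $x\sim y$ if $b(x,y)>0$ ("neighbors"). All weighted graphs are assumed connected (any two vertices are joined by a finite path of successive neighbors) and locally finite (each vertex has only finitely many neighbors). Let $d$ be the combinatorial graph metric (least number of edges of a path). For a vertex $x_0$ and $r\in\mathbb{N}_0=\{0,1,2,\dots\}$ put $S_r=\{x: d(x,x_0)=r\}$, with $S_{-1}=\emptyset$. For $x\in S_r$ let $\kappa_{\pm}(x)=\frac{1}{m(x)}\sum_{y\in S_{r\pm1}}b(x,y)$ (outer/inner curvatures with respect to $x_0$), and let $q=c/m$. A function on $V$ is spherically symmetric (with respect to $x_0$) if its values depend only on $d(\cdot,x_0)$. The graph is weakly spherically symmetric if it contains a vertex $x_0$ such that $\kappa_+$, $\kappa_-$ (with respect to $x_0$) and $q$ are spherically symmetric functions with respect to $x_0$. Let $\ell^2(V,m)$ be the real Hilbert space of $f:V\to\mathbb{R}$ with $\sum_x f(x)^2m(x)<\infty$, with inner product $\langle f,g\rangle=\sum_x f(x)g(x)m(x)$, and let $C_c(V)$ be the finitely supported functions. Let $Q(f,g)=\frac12\sum_{x,y}b(x,y)(f(x)-f(y))(g(x)-g(y))+\sum_x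 c(x)f(x)g(x)$, with domain $D(Q)$ equal to the closure of $C_c(V)$ in $\ell^2(V,m)$ with respect to $\langle\cdot,\cdot\rangle+Q(\cdot,\cdot)$. Let $L$ be the associated non-negative selfadjoint operator on $\ell^2(V,m)$: $Q(f,g)=\langle Lf,g\rangle$ for $f\in D(L)\subseteq D(Q)$, $g\in D(Q)$. The heat kernel is the map $p:[0,\infty)\times V\times V\to\mathbb{R}$ with $e^{-tL}f(x)=\sum_{y}p_t(x,y)f(y)m(y)$ for all $f\in\ell^2(V,m)$. The averaging operator $A$ associated to $x_0$ is the bounded operator on $\ell^2(V,m)$ given by $(Af)(x)=\frac{1}{m(S_r)}\sum_{y\in S_r}f(y)m(y)$ for $x\in S_r$. The heat kernel is called spherically symmetric if there is a vertex $x_0$ such that the averaging operator $A$ associated to $x_0$ commutes with $e^{-tL}$ for all $t\ge0$. *)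

theory Defs
  imports "HOL-Analysis.Analysis"
begin

text \<open>The vertex set is the universe of the type \<open>'v\<close>.\<close>

locale weighted_graph =
  fixes b :: "'v \<Rightarrow> 'v \<Rightarrow> real" and c :: "'v \<Rightarrow> real" and m :: "'v \<Rightarrow> real"
  assumes countable_V: "countable (UNIV :: 'v set)"
    and infinite_V: "infinite (UNIV :: 'v set)"
    and m_pos: "m x > 0"
    and b_nonneg: "b x y \<ge> 0"
    and b_sym: "b x y = b y x"
    and b_diag: "b x x = 0"
    and c_nonneg: "c x \<ge> 0"

definition edges :: "('v \<Rightarrow> 'v \<Rightarrow> real) \<Rightarrow> ('v \<times> 'v) set" where
  "edges b = {(x, y). b x y > 0}"

definition graph_connected :: "('v \<Rightarrow> 'v \<Rightarrow> real) \<Rightarrow> bool" where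
  "graph_connected b \<longleftrightarrow> (\<forall>x y. (x, y) \<in> (edges b)\<^sup>*)"

definition locally_finite_graph :: "('v \<Rightarrow> 'v \<Rightarrow> real) \<Rightarrow> bool" where
  "locally_finite_graph b \<longleftrightarrow> (\<forall>x. finite {y. b x y > 0})"

definition graph_dist :: "('v \<Rightarrow> 'v \<Rightarrow> real) \<Rightarrow> 'v \<Rightarrow> 'v \<Rightarrow> nat" where
  "graph_dist b x y = (LEAST n. (x, y) \<in> edges b ^^ n)"

text \<open>Radii are integers, so that the sphere of radius \<open>-1\<close> is empty.\<close>

definition graph_sphere :: "('v \<Rightarrow> 'v \<Rightarrow> real) \<Rightarrow> 'v \<Rightarrow> int \<Rightarrow> 'v set" where
  "graph_sphere b x0 r = {x. int (graph_dist b x x0) = r}"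

definition kappa_plus :: "('v \<Rightarrow> 'v \<Rightarrow> real) \<Rightarrow> ('v \<Rightarrow> real) \<Rightarrow> 'v \<Rightarrow> 'v \<Rightarrow> real" where
  "kappa_plus b m x0 x =
     1 / m x * (\<Sum>\<^sub>\<infinity>y\<in>graph_sphere b x0 (int (graph_dist b x x0) + 1). b x y)"

definition kappa_minus :: "('v \<Rightarrow> 'v \<Rightarrow> real) \<Rightarrow> ('v \<Rightarrow> real) \<Rightarrow> 'v \<Rightarrow> 'v \<Rightarrow> real" where
  "kappa_minus b m x0 x =
     1 / m x * (\<Sum>\<^sub>\<infinity>y\<in>graph_sphere b x0 (int (graph_dist b x x0) - 1). b x y)"

definition spherically_symmetric_fun ::
    "('v \<Rightarrow> 'v \<Rightarrow> real) \<Rightarrow> 'v \<Rightarrow> ('v \<Rightarrow> real) \<Rightarrow> bool" where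
  "spherically_symmetric_fun b x0 f \<longleftrightarrow>
     (\<forall>x y. graph_dist b x x0 = graph_dist b y x0 \<longrightarrow> f x = f y)"

definition weakly_spherically_symmetric ::
    "('v \<Rightarrow> 'v \<Rightarrow> real) \<Rightarrow> ('v \<Rightarrow> real) \<Rightarrow> ('v \<Rightarrow> real) \<Rightarrow> bool" where
  "weakly_spherically_symmetric b c m \<longleftrightarrow>
     (\<exists>x0. spherically_symmetric_fun b x0 (kappa_plus b m x0)
         \<and> spherically_symmetric_fun b x0 (kappa_minus b m x0)
         \<and> spherically_symmetric_fun b x0 (\<lambda>x. c x / m x))"

definition ell2 :: "('v \<Rightarrow> real) \<Rightarrow> ('v \<Rightarrow> real) set" where
  "ell2 m = {f. (\<lambda>x. (f x)\<^sup>2 * m x) summable_on UNIV}"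

definition ell2_inner :: "('v \<Rightarrow> real) \<Rightarrow> ('v \<Rightarrow> real) \<Rightarrow> ('v \<Rightarrow> real) \<Rightarrow> real" where
  "ell2_inner m f g = (\<Sum>\<^sub>\<infinity>x. f x * g x * m x)"

definition ell2_norm :: "('v \<Rightarrow> real) \<Rightarrow> ('v \<Rightarrow> real) \<Rightarrow> real" where
  "ell2_norm m f = sqrt (ell2_inner m f f)"

definition bounded_operator_ell2 ::
    "('v \<Rightarrow> real) \<Rightarrow> (('v \<Rightarrow> real) \<Rightarrow> ('v \<Rightarrow> real)) \<Rightarrow> bool" where
  "bounded_operator_ell2 m B \<longleftrightarrow>
     (\<forall>f\<in>ell2 m. B f \<in> ell2 m)
   \<and> (\<forall>f\<in>ell2 m. \<forall>g\<in>ell2 m. B (\<lambda>x. f x + g x) = (\<lambda>x. B f x + B g x))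
   \<and> (\<forall>a. \<forall>f\<in>ell2 m. B (\<lambda>x. a * f x) = (\<lambda>x. a * B f x))
   \<and> (\<exists>K. \<forall>f\<in>ell2 m. ell2_norm m (B f) \<le> K * ell2_norm m f)"

definition finitely_supported :: "('v \<Rightarrow> real) set" where
  "finitely_supported = {f. finite {x. f x \<noteq> 0}}"

definition form_Q ::
    "('v \<Rightarrow> 'v \<Rightarrow> real) \<Rightarrow> ('v \<Rightarrow> real) \<Rightarrow> ('v \<Rightarrow> real) \<Rightarrow> ('v \<Rightarrow> real) \<Rightarrow> real" where
  "form_Q b c f g =
     1 / 2 * (\<Sum>\<^sub>\<infinity>(x, y). b x y * (f x - f y) * (g x - g y)) + (\<Sum>\<^sub>\<infinity>x. c x * f x * g x)"

text \<open>Infinite sums that do not converge have the value 0, so finiteness of \<open>Q(f,f)\<close> has to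
  be expressed separately.\<close>

definition finite_energy ::
    "('v \<Rightarrow> 'v \<Rightarrow> real) \<Rightarrow> ('v \<Rightarrow> real) \<Rightarrow> ('v \<Rightarrow> real) \<Rightarrow> bool" where
  "finite_energy b c f \<longleftrightarrow>
     (\<lambda>(x, y). b x y * (f x - f y)\<^sup>2) summable_on UNIV \<and> (\<lambda>x. c x * (f x)\<^sup>2) summable_on UNIV"

definition form_domain ::
    "('v \<Rightarrow> 'v \<Rightarrow> real) \<Rightarrow> ('v \<Rightarrow> real) \<Rightarrow> ('v \<Rightarrow> real) \<Rightarrow> ('v \<Rightarrow> real) set" where
  "form_domain b c m =
     {f \<in> ell2 m. finite_energy b c f \<and>
        (\<exists>\<phi> :: nat \<Rightarrow> 'v \<Rightarrow> real. (\<forall>n. \<phi> n \<in> finitely_supported) \<and>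
           (\<lambda>n. ell2_inner m (\<lambda>x. f x - \<phi> n x) (\<lambda>x. f x - \<phi> n x)
                + form_Q b c (\<lambda>x. f x - \<phi> n x) (\<lambda>x. f x - \<phi> n x)) \<longlonglongrightarrow> 0)}"

definition L_domain ::
    "('v \<Rightarrow> 'v \<Rightarrow> real) \<Rightarrow> ('v \<Rightarrow> real) \<Rightarrow> ('v \<Rightarrow> real) \<Rightarrow> ('v \<Rightarrow> real) set" where
  "L_domain b c m =
     {f \<in> form_domain b c m.
        \<exists>h\<in>ell2 m. \<forall>g\<in>form_domain b c m. form_Q b c f g = ell2_inner m h g}"

definition L_op ::
    "('v \<Rightarrow> 'v \<Rightarrow> real) \<Rightarrow> ('v \<Rightarrow> real) \<Rightarrow> ('v \<Rightarrow> real) \<Rightarrow> ('v \<Rightarrow> real) \<Rightarrow> ('v \<Rightarrow> real)" where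
  "L_op b c m f =
     (THE h. h \<in> ell2 m \<and> (\<forall>g\<in>form_domain b c m. form_Q b c f g = ell2_inner m h g))"

definition C0_semigroup ::
    "('v \<Rightarrow> real) \<Rightarrow> (real \<Rightarrow> ('v \<Rightarrow> real) \<Rightarrow> ('v \<Rightarrow> real)) \<Rightarrow> bool" where
  "C0_semigroup m T \<longleftrightarrow>
     (\<forall>t\<ge>0. bounded_operator_ell2 m (T t))
   \<and> (\<forall>f\<in>ell2 m. T 0 f = f)
   \<and> (\<forall>s\<ge>0. \<forall>t\<ge>0. \<forall>f\<in>ell2 m. T (s + t) f = T s (T t f))
   \<and> (\<forall>f\<in>ell2 m. ((\<lambda>t. ell2_norm m (\<lambda>x. T t f x - f x)) \<longlongrightarrow> 0) (at_right 0))"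

definition generator_value ::
    "('v \<Rightarrow> real) \<Rightarrow> (real \<Rightarrow> ('v \<Rightarrow> real) \<Rightarrow> ('v \<Rightarrow> real)) \<Rightarrow>
     ('v \<Rightarrow> real) \<Rightarrow> ('v \<Rightarrow> real) \<Rightarrow> bool" where
  "generator_value m T f h \<longleftrightarrow>
     f \<in> ell2 m \<and> h \<in> ell2 m \<and>
     ((\<lambda>t. ell2_norm m (\<lambda>x. (T t f x - f x) / t - h x)) \<longlongrightarrow> 0) (at_right 0)"

text \<open>The operators \<open>e\<^bsup>-tL\<^esup>\<close>, \<open>t \<ge> 0\<close>, form the strongly continuous semigroup whose generator,
  domain included, is \<open>-L\<close>. A strongly continuous semigroup is determined by its generator, so
  all choices agree for \<open>t \<ge> 0\<close> on square-summable functions; elsewhere the value is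
  irrelevant.\<close>

definition heat_semigroup ::
    "('v \<Rightarrow> 'v \<Rightarrow> real) \<Rightarrow> ('v \<Rightarrow> real) \<Rightarrow> ('v \<Rightarrow> real) \<Rightarrow>
     real \<Rightarrow> ('v \<Rightarrow> real) \<Rightarrow> ('v \<Rightarrow> real)" where
  "heat_semigroup b c m =
     (SOME T. C0_semigroup m T \<and>
        (\<forall>f h. generator_value m T f h \<longleftrightarrow> f \<in> L_domain b c m \<and> h = (\<lambda>x. - L_op b c m f x)))"

definition averaging_op ::
    "('v \<Rightarrow> 'v \<Rightarrow> real) \<Rightarrow> ('v \<Rightarrow> real) \<Rightarrow> 'v \<Rightarrow> ('v \<Rightarrow> real) \<Rightarrow> ('v \<Rightarrow> real)" where
  "averaging_op b m x0 f x =
     (let S = graph_sphere b x0 (int (graph_dist b x x0))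
      in 1 / (\<Sum>\<^sub>\<infinity>y\<in>S. m y) * (\<Sum>\<^sub>\<infinity>y\<in>S. f y * m y))"

definition heat_kernel_spherically_symmetric ::
    "('v \<Rightarrow> 'v \<Rightarrow> real) \<Rightarrow> ('v \<Rightarrow> real) \<Rightarrow> ('v \<Rightarrow> real) \<Rightarrow> bool" where
  "heat_kernel_spherically_symmetric b c m \<longleftrightarrow>
     (\<exists>x0. \<forall>t\<ge>0. \<forall>f\<in>ell2 m.
        averaging_op b m x0 (heat_semigroup b c m t f)
          = heat_semigroup b c m t (averaging_op b m x0 f))"

end

theory Submission imports Defs begin

text \<open>The link between the two notions is the formal Laplacian on finitely supported
functions. On a function \<open>F(r(x))\<close> of the distance \<open>r(x)\<close> to \<open>x0\<close> its value at \<open>x\<close> is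
\<open>\<kappa>\<^sub>+(x) (F(r) - F(r+1)) + \<kappa>\<^sub>-(x) (F(r) - F(r-1)) + q(x) F(r)\<close>, because edges join only
vertices of the same or of adjacent spheres (lemma \<open>laplacian_radial\<close>). So the Laplacian
preserves radial functions exactly when the curvatures \<open>\<kappa>\<^sub>+\<close>, \<open>\<kappa>\<^sub>-\<close> and \<open>q\<close> are radial: one
direction is visible from the formula, the other follows by inserting indicator functions of
spheres.

If the averaging operator commutes with the heat semigroup, differentiating at time \<open>0\<close> shows
that it commutes with the Laplacian on finitely supported functions. An indicator function of
a sphere is the average of a multiple of a point mass, so its Laplacian is an average, hence
radial (lemma \<open>laplacian_sphere_radial\<close>).

Conversely, let the Laplacian preserve radial functions. Averaging is the orthogonal
projection onto the closed subspace of radial functions, so by Green's formula it is symmetric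
for the form on finitely supported functions, and does not increase the energy. Approximation
in the form norm then extends this to the form domain, and averaging commutes with the
operator \<open>L\<close> (lemma \<open>proj_L_graph\<close>). To pass from \<open>L\<close> to the semigroup one uses the formula
\<open>e\<^sup>-\<^sup>t\<^sup>L = lim (1 + (t/n) L)\<^sup>-\<^sup>n\<close>: a bounded operator that commutes with \<open>L\<close> commutes with its
resolvents, hence with the limit (lemma \<open>semigroup_commute\<close>).

The heat semigroup is specified by its generator, so its existence is part of the proof, and
the resolvent formula must be shown for an arbitrary strongly continuous semigroup with
generator \<open>-L\<close>. Both are done in an abstract Hilbert space, for a densely defined linear
monotone relation \<open>G\<close> such that \<open>1 + l G\<close> is onto for all \<open>l > 0\<close>. Everything rests on the
identity \<open>J\<^sub>l\<^sub>+\<^sub>k f - J\<^sub>l J\<^sub>k f = l k J\<^sub>l\<^sub>+\<^sub>k J\<^sub>l J\<^sub>k G\<^sup>2 f\<close> for the resolvents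
\<open>J\<^sub>l = (1 + l G)\<^sup>-\<^sup>1\<close>, which are commuting contractions: comparing powers of such operators
costs only the number of factors times the error of one factor. The resolvents of \<open>L\<close> come
from the orthogonal projection onto the closed graph of the gradient: the form is the inner
product of gradients, so its closure is the closure of that graph.\<close>

section \<open>Hilbert space preliminaries\<close>

text \<open>A minimising sequence for the distance to \<open>S\<close> is Cauchy by the parallelogram law; at the
minimum, moving in a direction \<open>v\<close> of \<open>S\<close> by the optimal multiple cannot help, which forces
orthogonality.\<close>

lemma orthogonal_projection_exists:
  fixes S :: "'a::{real_inner,banach} set"
  assumes "subspace S" and "closed S"
  shows "\<exists>p\<in>S. \<forall>v\<in>S. inner (u - p) v = 0"
proof -
  define d where "d = Inf ((\<lambda>s. (norm (u - s))\<^sup>2) ` S)"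
  have S0: "0 \<in> S" using assms(1) by (rule subspace_0)
  have bdd: "bdd_below ((\<lambda>s. (norm (u - s))\<^sup>2) ` S)"
    by (rule bdd_belowI2[of _ 0]) auto
  have d_le: "d \<le> (norm (u - s))\<^sup>2" if "s \<in> S" for s
    unfolding d_def using bdd that by (intro cInf_lower) auto
  have "\<exists>s\<in>S. (norm (u - s))\<^sup>2 < d + 1 / real (Suc n)" for n
  proof -
    have "Inf ((\<lambda>s. (norm (u - s))\<^sup>2) ` S) < d + 1 / real (Suc n)"
      unfolding d_def by simp
    from cInf_lessD[OF _ this] S0 show ?thesis by auto
  qed
  then obtain s where s: "\<And>n. s n \<in> S" "\<And>n. (norm (u - s n))\<^sup>2 < d + 1 / real (Suc n)"
    by metis
  have par: "(norm (s i - s j))\<^sup>2 \<le> 2 / real (Suc i) + 2 / real (Suc j)" for i j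
  proof -
    have "(1/2) *\<^sub>R (s i + s j) \<in> S"
      using s(1) assms(1) by (intro subspace_scale subspace_add) auto
    from d_le[OF this] have "4 * d \<le> (norm (2 *\<^sub>R (u - (1/2) *\<^sub>R (s i + s j))))\<^sup>2"
      by (simp add: power_mult_distrib)
    also have "2 *\<^sub>R (u - (1/2) *\<^sub>R (s i + s j)) = (u - s i) + (u - s j)"
      by (simp add: algebra_simps scaleR_2)
    finally have "4 * d \<le> (norm ((u - s i) + (u - s j)))\<^sup>2" .
    moreover have "(norm ((u - s i) + (u - s j)))\<^sup>2 + (norm (s i - s j))\<^sup>2
        = 2 * (norm (u - s i))\<^sup>2 + 2 * (norm (u - s j))\<^sup>2"
      by (simp add: power2_norm_eq_inner inner_diff inner_add inner_commute algebra_simps)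
    ultimately show ?thesis using s(2)[of i] s(2)[of j] by linarith
  qed
  have "Cauchy s"
  proof (rule metric_CauchyI)
    fix e :: real assume e: "e > 0"
    obtain N where N: "4 / e\<^sup>2 < real N" using reals_Archimedean2 by blast
    have "dist (s i) (s j) < e" if "i \<ge> N" "j \<ge> N" for i j
    proof -
      have N0: "real N > 0" using N e by (smt (verit) divide_nonneg_nonneg zero_le_power2)
      have "2 / real (Suc i) \<le> 2 / real N" "2 / real (Suc j) \<le> 2 / real N"
        using that N0 by (auto intro!: divide_left_mono)
      hence "(norm (s i - s j))\<^sup>2 \<le> 4 / real N" using par[of i j] by linarith
      also have "\<dots> < e\<^sup>2" using N N0 e by (simp add: field_simps)
      finally show ?thesis using e by (simp add: dist_norm power_less_imp_less_base)
    qed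
    thus "\<exists>M. \<forall>m\<ge>M. \<forall>n\<ge>M. dist (s m) (s n) < e" by blast
  qed
  then obtain p where p: "s \<longlonglongrightarrow> p" using Cauchy_convergent_iff convergent_def by blast
  have pS: "p \<in> S" using closed_sequentially[OF assms(2)] s(1) p by blast
  have "(\<lambda>n. (norm (u - s n))\<^sup>2) \<longlonglongrightarrow> (norm (u - p))\<^sup>2" by (intro tendsto_intros p)
  moreover have "(\<lambda>n. d + 1 / real (Suc n)) \<longlonglongrightarrow> d + 0"
    by (intro tendsto_add tendsto_const LIMSEQ_Suc lim_1_over_n)
  ultimately have pd: "(norm (u - p))\<^sup>2 \<le> d"
    using s(2) by (metis (no_types, lifting) LIMSEQ_le less_imp_le add.right_neutral)
  have "inner (u - p) v = 0" if v: "v \<in> S" for v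
  proof (cases "v = 0")
    case False
    define t where "t = inner (u - p) v / inner v v"
    have "p + t *\<^sub>R v \<in> S" using pS v assms(1) by (intro subspace_add subspace_scale)
    from d_le[OF this] have "d \<le> (norm ((u - p) - t *\<^sub>R v))\<^sup>2"
      by (simp only: diff_diff_add)
    with pd have "(norm (u - p))\<^sup>2 \<le> (norm ((u - p) - t *\<^sub>R v))\<^sup>2"
      by linarith
    also have "\<dots> = (norm (u - p))\<^sup>2 - 2 * t * inner (u - p) v + t\<^sup>2 * inner v v"
      unfolding power2_norm_eq_inner
      by (simp add: inner_diff_left inner_diff_right inner_commute algebra_simps power2_eq_square)
    also have "\<dots> = (norm (u - p))\<^sup>2 - (inner (u - p) v)\<^sup>2 / inner v v"
      using False by (simp add: t_def field_simps power2_eq_square)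
    finally have "(inner (u - p) v)\<^sup>2 / inner v v \<le> 0" by simp
    moreover have "inner v v > 0" using False by simp
    ultimately show ?thesis
      by (smt (verit) divide_pos_pos zero_less_power2)
  qed simp
  thus ?thesis using pS by blast
qed

lemma orthogonal_projection_operator:
  fixes S :: "'a::{real_inner,banach} set"
  assumes S: "subspace S" "closed S"
  obtains P where "bounded_linear P" "\<And>u. P u \<in> S" "\<And>u v. v \<in> S \<Longrightarrow> inner (P u) v = inner u v"
proof -
  from orthogonal_projection_exists[OF S]
  obtain P where P: "\<And>u. P u \<in> S" "\<And>u v. v \<in> S \<Longrightarrow> inner (u - P u) v = 0" by metis
  have Pi: "inner (P u) v = inner u v" if "v \<in> S" for u v
    using P(2)[OF that, of u] by (simp add: inner_diff_left)
  have eqI: "p = q" if "p \<in> S" "q \<in> S" "\<And>v. v \<in> S \<Longrightarrow> inner p v = inner q v" for p q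
  proof -
    have "p - q \<in> S" using that(1,2) by (rule subspace_diff[OF S(1)])
    from that(3)[OF this] have "inner (p - q) (p - q) = 0" by (simp add: inner_diff_left)
    thus ?thesis by simp
  qed
  have "bounded_linear P"
  proof (rule bounded_linear_intro[of _ 1])
    show "P (u + v) = P u + P v" for u v
      by (rule eqI) (simp_all add: P(1) subspace_add[OF S(1)] Pi inner_add_left)
    show "P (a *\<^sub>R u) = a *\<^sub>R P u" for a u
      by (rule eqI) (simp_all add: P(1) subspace_scale[OF S(1)] Pi)
    show "norm (P u) \<le> norm u * 1" for u
    proof -
      have "norm (P u) * norm (P u) = inner (P u) (P u)"
        by (simp add: dot_square_norm power2_eq_square)
      also have "\<dots> = inner u (P u)" by (rule Pi[OF P(1)])
      also have "\<dots> \<le> norm u * norm (P u)" by (rule norm_cauchy_schwarz)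
      finally show ?thesis by (cases "norm (P u) = 0") (auto simp: mult_le_cancel_right)
    qed
  qed
  thus ?thesis using that P(1) Pi by blast
qed

lemma subspace_closure:
  fixes M :: "'a::real_normed_vector set"
  assumes "subspace M"
  shows "subspace (closure M)"
proof (rule subspaceI)
  show "0 \<in> closure M" using subspace_0[OF assms] closure_subset by blast
next
  fix x y assume "x \<in> closure M" "y \<in> closure M"
  then obtain a b where "\<And>n. a n \<in> M" "a \<longlonglongrightarrow> x" "\<And>n. b n \<in> M" "b \<longlonglongrightarrow> y"
    unfolding closure_sequential by blast
  thus "x + y \<in> closure M"
    unfolding closure_sequential using subspace_add[OF assms]
    by (intro exI[of _ "\<lambda>n. a n + b n"]) (auto intro: tendsto_add)
next
  fix c x assume "x \<in> closure M"
  then obtain a where "\<And>n. a n \<in> M" "a \<longlonglongrightarrow> x"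
    unfolding closure_sequential by blast
  thus "c *\<^sub>R x \<in> closure M"
    unfolding closure_sequential using subspace_scale[OF assms]
    by (intro exI[of _ "\<lambda>n. c *\<^sub>R a n"]) (auto intro: tendsto_scaleR)
qed

lemma inner_self_le_0D: "inner x x \<le> 0 \<Longrightarrow> x = (0::'a::real_inner)"
  by (meson inner_gt_zero_iff not_less)

text \<open>A form of the uniform boundedness principle for complete spaces. Starting from any
point, a step of length \<open>3\<^sup>-\<^sup>n\<close> in a direction that nearly attains the operator norm can be
taken with a sign that makes the image under \<open>T n\<close> large, and all later steps together are too
short to undo this.\<close>

lemma gliding_hump:
  fixes T :: "nat \<Rightarrow> 'a::banach \<Rightarrow> 'b::real_normed_vector"
  assumes bl: "\<And>n. bounded_linear (T n)" and big: "\<And>n. onorm (T n) > 4 ^ n"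
  shows "\<exists>x. \<not> Bseq (\<lambda>n. T n x)"
proof -
  have "\<exists>z. norm z = (1/3) ^ n \<and> norm (T n z) > 2/3 * onorm (T n) * (1/3) ^ n" for n
  proof -
    have o: "onorm (T n) > 0" by (rule less_trans[OF _ big]) simp
    have "\<not> (\<forall>x. norm (T n x) \<le> (2/3 * onorm (T n)) * norm x)"
    proof
      assume "\<forall>x. norm (T n x) \<le> (2/3 * onorm (T n)) * norm x"
      hence "onorm (T n) \<le> 2/3 * onorm (T n)" using o by (intro onorm_bound) auto
      thus False using o by simp
    qed
    then obtain x where x: "norm (T n x) > 2/3 * onorm (T n) * norm x"
      unfolding not_all not_le by blast
    have "T n 0 = 0" by (rule linear_0[OF bounded_linear.linear[OF bl]])
    hence "x \<noteq> 0" using x by (intro notI) simp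
    hence x0: "norm x > 0" by simp
    define z where "z = ((1/3) ^ n / norm x) *\<^sub>R x"
    have "norm z = (1/3) ^ n" using x0 by (simp add: z_def)
    moreover have "norm (T n z) = (1/3) ^ n / norm x * norm (T n x)"
      using x0 by (simp add: z_def bounded_linear.linear[OF bl] linear_scale)
    hence "norm (T n z) > (1/3) ^ n / norm x * (2/3 * onorm (T n) * norm x)"
      using mult_strict_left_mono[OF x, of "(1/3) ^ n / norm x"] x0 by simp
    moreover have "(1/3) ^ n / norm x * (2/3 * onorm (T n) * norm x) = 2/3 * onorm (T n) * (1/3) ^ n"
      using x0 by simp
    ultimately show ?thesis by metis
  qed
  then obtain z where z: "\<And>n. norm (z n) = (1/3) ^ n"
      "\<And>n. norm (T n (z n)) > 2/3 * onorm (T n) * (1/3) ^ n" by metis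
  \<comment> \<open>Of the images of \<open>x + z n\<close> and \<open>x - z n\<close> at least one is as large as the image of \<open>z n\<close>.\<close>
  define step where
    "step n x = (if norm (T n (x + z n)) \<ge> norm (T n (z n)) then x + z n else x - z n)" for n x
  define X where "X = rec_nat (0::'a) step"
  have X_Suc: "X (Suc n) = step n (X n)" for n by (simp add: X_def)
  have step_large: "norm (T n (z n)) \<le> norm (T n (step n x))" for n x
  proof -
    have "T n (x + z n) - T n (x - z n) = 2 *\<^sub>R T n (z n)"
      using bounded_linear.linear[OF bl[of n]] by (simp add: linear_add linear_diff scaleR_2)
    hence "2 * norm (T n (z n)) \<le> norm (T n (x + z n)) + norm (T n (x - z n))"
      using norm_triangle_ineq4[of "T n (x + z n)" "T n (x - z n)"] by simp
    thus ?thesis by (auto simp: step_def)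
  qed
  have diff: "norm (X (Suc n) - X n) \<le> (1/3) ^ n" for n
    by (simp add: X_Suc step_def z)
  have sm: "summable (\<lambda>n. X (Suc n) - X n)"
    by (rule summable_comparison_test'[OF summable_geometric[of "1/3::real"]]) (use diff in auto)
  hence "convergent X" by (subst (asm) summable_iff_convergent) (simp add: sum_lessThan_telescope
        convergent_diff_const_right_iff)
  then obtain x where x: "X \<longlonglongrightarrow> x" by (auto simp: convergent_def)
  have tail: "norm (x - X (Suc n)) \<le> 1/2 * (1/3) ^ n" for n
  proof -
    have "norm (X (Suc (n + k)) - X (Suc n)) \<le> 1/2 * (1/3) ^ n * (1 - (1/3) ^ k)" for k
    proof (induction k)
      case (Suc k)
      have "norm (X (Suc (n + Suc k)) - X (Suc n))
          \<le> norm (X (Suc (Suc (n + k))) - X (Suc (n + k))) + norm (X (Suc (n + k)) - X (Suc n))"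
        using norm_triangle_ineq[of "X (Suc (Suc (n + k))) - X (Suc (n + k))" "X (Suc (n + k)) - X (Suc n)"]
        by simp
      also have "\<dots> \<le> (1/3) ^ Suc (n + k) + 1/2 * (1/3) ^ n * (1 - (1/3) ^ k)"
        by (intro add_mono diff Suc)
      also have "\<dots> = 1/2 * (1/3) ^ n * (1 - (1/3) ^ Suc k)"
        by (simp add: power_add right_diff_distrib)
      finally show ?case .
    qed simp
    moreover have "1/2 * (1/3::real) ^ n * (1 - (1/3) ^ k) \<le> 1/2 * (1/3) ^ n" for k
      by simp
    ultimately have "norm (X (Suc (n + k)) - X (Suc n)) \<le> 1/2 * (1/3) ^ n" for k
      by (rule order.trans)
    hence "norm (X (k + Suc n) - X (Suc n)) \<le> 1/2 * (1/3) ^ n" for k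
      by (simp only: add_Suc_right add.commute)
    moreover have "(\<lambda>k. norm (X (k + Suc n) - X (Suc n))) \<longlonglongrightarrow> norm (x - X (Suc n))"
      by (intro tendsto_intros LIMSEQ_ignore_initial_segment x)
    ultimately show ?thesis using LIMSEQ_le_const2 by blast
  qed
  have low: "norm (T n x) \<ge> 1/6 * (4/3) ^ n" for n
  proof -
    have "norm (T n (x - X (Suc n))) \<le> onorm (T n) * norm (x - X (Suc n))"
      by (rule onorm[OF bl])
    also have "\<dots> \<le> onorm (T n) * (1/2 * (1/3) ^ n)"
      by (intro mult_left_mono tail onorm_pos_le bl)
    finally have "norm (T n (x - X (Suc n))) \<le> 1/2 * onorm (T n) * (1/3) ^ n" by simp
    moreover have "norm (T n (X (Suc n))) > 2/3 * onorm (T n) * (1/3) ^ n"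
      using step_large[of n "X n"] z(2)[of n] by (simp add: X_Suc)
    moreover have "T n x = T n (x - X (Suc n)) + T n (X (Suc n))"
      using bounded_linear.linear[OF bl[of n]] by (simp add: linear_diff)
    ultimately have "norm (T n x) \<ge> 1/6 * (onorm (T n) * (1/3) ^ n)"
      using norm_diff_ineq[of "T n (X (Suc n))" "T n (x - X (Suc n))"] by (simp add: add.commute)
    moreover have "onorm (T n) * (1/3) ^ n \<ge> 4 ^ n * (1/3) ^ n"
      using big[of n] by (intro mult_right_mono) auto
    moreover have "4 ^ n * (1/3) ^ n = (4/3::real) ^ n"
      by (simp only: power_mult_distrib[symmetric]) simp
    ultimately show ?thesis by linarith
  qed
  have "\<not> Bseq (\<lambda>n. T n x)"
  proof
    assume "Bseq (\<lambda>n. T n x)"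
    then obtain K where K: "\<And>n. norm (T n x) \<le> K" unfolding Bseq_def by blast
    obtain n where "6 * K < (4/3::real) ^ n" using real_arch_pow[of "4/3::real" "6 * K"] by auto
    thus False using low[of n] K[of n] by linarith
  qed
  thus ?thesis by blast
qed

lemma linear_funpow:
  fixes P :: "'a::real_vector \<Rightarrow> 'a"
  assumes "linear P"
  shows "linear (P ^^ n)"
  by (induction n) (use assms linear_id linear_compose in \<open>auto simp: id_def o_def\<close>)

lemma norm_funpow_le:
  fixes P :: "'a::real_normed_vector \<Rightarrow> 'a"
  assumes "\<And>u. norm (P u) \<le> norm u"
  shows "norm ((P ^^ n) u) \<le> norm u"
  by (induction n) (auto intro: order.trans[OF assms])

text \<open>Telescoping: \<open>P\<^sup>n - R\<^sup>n\<close> is a sum of \<open>n\<close> terms \<open>P\<^sup>j R\<^sup>i (P - R)\<close>. The bound \<open>M\<close> on the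
powers of \<open>P\<close> admits semigroups that are only known to be locally bounded.\<close>

lemma norm_funpow_diff_le:
  fixes P R :: "'a::real_normed_vector \<Rightarrow> 'a"
  assumes lin: "linear P" "linear R" and comm: "\<And>u. P (R u) = R (P u)"
    and R: "\<And>u. norm (R u) \<le> norm u"
    and P: "\<And>j u. j < n \<Longrightarrow> norm ((P ^^ j) u) \<le> M * norm u"
  shows "norm ((P ^^ n) u - (R ^^ n) u) \<le> real n * (M * norm (P u - R u))"
  using P
proof (induction n)
  case (Suc n)
  have PR: "(P ^^ k) (R v) = R ((P ^^ k) v)" for k v
    by (induction k) (auto simp: comm)
  have "(P ^^ Suc n) u - (R ^^ Suc n) u = (P ^^ n) (P u - R u) + R ((P ^^ n) u - (R ^^ n) u)"
    by (simp add: funpow_Suc_right linear_diff[OF linear_funpow[OF lin(1)]] linear_diff[OF lin(2)] PR del: funpow.simps)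
       (simp add: funpow_swap1)
  hence "norm ((P ^^ Suc n) u - (R ^^ Suc n) u)
      \<le> norm ((P ^^ n) (P u - R u)) + norm (R ((P ^^ n) u - (R ^^ n) u))"
    by (simp only: norm_triangle_ineq)
  also have "\<dots> \<le> M * norm (P u - R u) + real n * (M * norm (P u - R u))"
    using Suc by (intro add_mono order.trans[OF R]) auto
  finally show ?case by (simp add: algebra_simps)
qed simp

lemma convergent_contractions_of_dense:
  fixes P :: "nat \<Rightarrow> 'a::banach \<Rightarrow> 'a"
  assumes lin: "\<And>n. linear (P n)" and con: "\<And>n u. norm (P n u) \<le> norm u"
    and D: "closure D = UNIV" and conv: "\<And>u. u \<in> D \<Longrightarrow> convergent (\<lambda>n. P n u)"
  shows "convergent (\<lambda>n. P n u)"
proof -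
  have "Cauchy (\<lambda>n. P n u)"
  proof (rule metric_CauchyI)
    fix e :: real assume e: "e > 0"
    obtain v where v: "v \<in> D" "dist v u < e/3"
      using D e by (metis UNIV_I closure_approachable divide_pos_pos zero_less_numeral)
    obtain N where N: "\<And>i j. i \<ge> N \<Longrightarrow> j \<ge> N \<Longrightarrow> dist (P i v) (P j v) < e/3"
      using metric_CauchyD[OF convergent_Cauchy[OF conv[OF v(1)]], of "e/3"] e by auto
    have close: "dist (P i u) (P i v) < e/3" for i
      using con[of i "u - v"] v(2) by (simp add: linear_diff[OF lin] dist_norm norm_minus_commute)
    have "dist (P i u) (P j u) < e" if "i \<ge> N" "j \<ge> N" for i j
      using N[OF that] close[of i] close[of j]
        dist_triangle[of "P i u" "P j u" "P i v"] dist_triangle[of "P i v" "P j u" "P j v"]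
      by (simp add: dist_commute)
    thus "\<exists>M. \<forall>m\<ge>M. \<forall>n\<ge>M. dist (P m u) (P n u) < e" by blast
  qed
  thus ?thesis by (rule Cauchy_convergent)
qed

lemma tendsto_contractions_of_dense:
  fixes P :: "'i \<Rightarrow> 'a::real_normed_vector \<Rightarrow> 'a"
  assumes lin: "\<forall>\<^sub>F i in F. linear (P i)" and con: "\<forall>\<^sub>F i in F. \<forall>u. norm (P i u) \<le> norm u"
    and D: "closure D = UNIV" and conv: "\<And>u. u \<in> D \<Longrightarrow> ((\<lambda>i. P i u) \<longlongrightarrow> u) F"
  shows "((\<lambda>i. P i u) \<longlongrightarrow> u) F"
proof (rule tendstoI)
  fix e :: real assume e: "e > 0"
  obtain v where v: "v \<in> D" "dist v u < e/3"
    using D e by (metis UNIV_I closure_approachable divide_pos_pos zero_less_numeral)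
  have "\<forall>\<^sub>F i in F. dist (P i v) v < e/3" using e by (intro tendstoD[OF conv[OF v(1)]]) simp
  with lin con show "\<forall>\<^sub>F i in F. dist (P i u) u < e"
  proof eventually_elim
    case (elim i)
    have "norm (P i (u - v)) \<le> norm (u - v)" using elim by blast
    hence "dist (P i u) (P i v) < e/3"
      using v(2) by (simp add: linear_diff[OF elim(1)] dist_norm norm_minus_commute)
    thus ?case using elim(3) v(2)
        dist_triangle[of "P i u" u "P i v"] dist_triangle[of "P i v" u v] by linarith
  qed
qed

section \<open>Contraction semigroups generated by monotone linear relations\<close>

text \<open>An unbounded operator is represented by its graph \<open>G\<close>, so that no separate domain has to
be carried along. The conditions are those of the Lumer--Phillips theorem for \<open>-G\<close>.\<close>

locale maximal_monotone =
  fixes G :: "('a::{real_inner,banach} \<times> 'a) set"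
  assumes subspace_G: "subspace G"
    and monotone_G: "(f, h) \<in> G \<Longrightarrow> 0 \<le> inner f h"
    and range_G: "0 < l \<Longrightarrow> \<exists>f h. (f, h) \<in> G \<and> f + l *\<^sub>R h = g"
    and dense_G: "closure (Domain G) = UNIV"
begin

lemma G_add: "(f, h) \<in> G \<Longrightarrow> (f', h') \<in> G \<Longrightarrow> (f + f', h + h') \<in> G"
  using subspace_add[OF subspace_G, of "(f, h)" "(f', h')"] by simp

lemma G_diff: "(f, h) \<in> G \<Longrightarrow> (f', h') \<in> G \<Longrightarrow> (f - f', h - h') \<in> G"
  using subspace_diff[OF subspace_G, of "(f, h)" "(f', h')"] by simp

lemma G_scale: "(f, h) \<in> G \<Longrightarrow> (a *\<^sub>R f, a *\<^sub>R h) \<in> G"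
  using subspace_scale[OF subspace_G, of "(f, h)" a] by simp

text \<open>The resolvent \<open>(1 + l G)\<^sup>-\<^sup>1\<close>. At \<open>l = 0\<close> it is set to the identity, and not to the
identity of the domain of \<open>G\<close>, so that the algebraic laws below hold on the whole space for
all \<open>l \<ge> 0\<close>.\<close>

definition resolvent :: "real \<Rightarrow> 'a \<Rightarrow> 'a" where
  "resolvent l g = (if l = 0 then g else THE f. (f, (g - f) /\<^sub>R l) \<in> G)"

lemma resolvent_eqI:
  assumes G: "(f, h) \<in> G" and l: "0 \<le> l"
  shows "resolvent l (f + l *\<^sub>R h) = f"
proof (cases "l = 0")
  case False
  hence l: "l > 0" using l by simp
  have "(THE f'. (f', (f + l *\<^sub>R h - f') /\<^sub>R l) \<in> G) = f"
  proof (rule the_equality)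
    show "(f, (f + l *\<^sub>R h - f) /\<^sub>R l) \<in> G" using G l by simp
    fix f' assume "(f', (f + l *\<^sub>R h - f') /\<^sub>R l) \<in> G"
    from monotone_G[OF G_diff[OF G this]]
    have "0 \<le> inner (f - f') (h - (f + l *\<^sub>R h - f') /\<^sub>R l)" .
    also have "h - (f + l *\<^sub>R h - f') /\<^sub>R l = - (inverse l *\<^sub>R (f - f'))"
      using l by (simp add: algebra_simps)
    finally have "inverse l * inner (f - f') (f - f') \<le> 0" by simp
    hence "inner (f - f') (f - f') \<le> 0" using l by (simp add: mult_le_0_iff)
    thus "f' = f" using inner_self_le_0D[of "f - f'"] by simp
  qed
  thus ?thesis using l by (simp add: resolvent_def)
qed (simp add: resolvent_def)

lemma resolvent_0 [simp]: "resolvent 0 g = g"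
  by (simp add: resolvent_def)

lemma resolvent_in: "0 < l \<Longrightarrow> (resolvent l g, (g - resolvent l g) /\<^sub>R l) \<in> G"
  using range_G[of l g] resolvent_eqI[of _ _ l] by force

lemma linear_resolvent:
  assumes l: "0 \<le> l"
  shows "linear (resolvent l)"
proof (cases "l = 0")
  case True
  thus ?thesis by (simp add: resolvent_def[abs_def] linear_id[unfolded id_def])
next
  case False
  hence l: "l > 0" using l by simp
  show ?thesis
  proof (rule linearI)
    fix u v
    show "resolvent l (u + v) = resolvent l u + resolvent l v"
      using resolvent_eqI[OF G_add[OF resolvent_in resolvent_in], OF l l, of l u v] l
        by (simp add: algebra_simps)
  next
    fix r u
    show "resolvent l (r *\<^sub>R u) = r *\<^sub>R resolvent l u"
    proof -
      have "r *\<^sub>R resolvent l u + l *\<^sub>R (r *\<^sub>R ((u - resolvent l u) /\<^sub>R l)) = r *\<^sub>R u"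
      proof -
        have "l *\<^sub>R (r *\<^sub>R ((u - resolvent l u) /\<^sub>R l)) = (l * (r * inverse l)) *\<^sub>R (u - resolvent l u)"
          by simp
        also have "l * (r * inverse l) = r" using l by simp
        finally show ?thesis by (simp add: scaleR_diff_right)
      qed
      thus ?thesis using resolvent_eqI[OF G_scale[OF resolvent_in[OF l, of u]], of l r] l by simp
    qed
  qed
qed

lemma norm_resolvent_le:
  assumes l: "0 \<le> l"
  shows "norm (resolvent l u) \<le> norm u"
proof (cases "l = 0")
  case False
  hence l: "l > 0" using l by simp
  have "0 \<le> inverse l * inner (resolvent l u) (u - resolvent l u)"
    using monotone_G[OF resolvent_in[OF l, of u]] by simp
  hence "inner (resolvent l u) (resolvent l u) \<le> inner (resolvent l u) u"
    using l by (simp add: zero_le_mult_iff inner_diff_right)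
  also have "\<dots> \<le> norm (resolvent l u) * norm u" by (rule norm_cauchy_schwarz)
  finally have "norm (resolvent l u) * norm (resolvent l u) \<le> norm (resolvent l u) * norm u"
    by (simp add: dot_square_norm power2_eq_square)
  thus ?thesis by (cases "norm (resolvent l u) = 0") (auto simp: mult_le_cancel_left)
qed simp

text \<open>Stated for an arbitrary \<open>A\<close> because it serves three purposes: resolvents commute with
each other, with the semigroup, and with the symmetries of \<open>G\<close>.\<close>

lemma resolvent_commute:
  assumes A: "linear A" and inv: "\<And>f h. (f, h) \<in> G \<Longrightarrow> (A f, A h) \<in> G" and l: "0 \<le> l"
  shows "A (resolvent l u) = resolvent l (A u)"
proof (cases "l = 0")
  case False
  hence l: "l > 0" using l by simp
  from resolvent_eqI[OF inv[OF resolvent_in[OF l]], of l u] l show ?thesis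
    by (simp add: linear_diff[OF A] linear_scale[OF A])
qed simp

lemma resolvent_G:
  assumes G: "(f, h) \<in> G" and l: "0 \<le> l"
  shows "(resolvent l f, resolvent l h) \<in> G"
proof (cases "l = 0")
  case False
  hence l: "l > 0" using l by simp
  have "resolvent l f + l *\<^sub>R resolvent l h = f"
    using resolvent_eqI[OF G, of l] l linear_resolvent[of l]
      by (simp add: linear_add linear_scale)
  hence "f - resolvent l f = l *\<^sub>R resolvent l h" by (simp add: algebra_simps)
  hence "(f - resolvent l f) /\<^sub>R l = resolvent l h" using l by simp
  thus ?thesis using resolvent_in[OF l, of f] by simp
qed (use G in simp)

lemma resolvent_resolvent: "0 \<le> l \<Longrightarrow> 0 \<le> k \<Longrightarrow> resolvent l (resolvent k u) = resolvent k (resolvent l u)"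
  by (rule resolvent_commute) (auto intro: linear_resolvent resolvent_G)

lemma resolvent_decomp:
  assumes "(f, h) \<in> G" and l: "0 \<le> l"
  shows "resolvent l f + l *\<^sub>R resolvent l h = f"
  using resolvent_eqI[OF assms] linear_resolvent[OF l] by (simp add: linear_add linear_scale)

lemma norm_resolvent_diff_le:
  assumes "(f, h) \<in> G" and l: "0 \<le> l"
  shows "norm (resolvent l f - f) \<le> l * norm h"
proof -
  have "resolvent l f - f = - (l *\<^sub>R resolvent l h)"
    using resolvent_decomp[OF assms] by (simp add: algebra_simps)
  hence "norm (resolvent l f - f) = l * norm (resolvent l h)" using l by simp
  thus ?thesis using norm_resolvent_le[OF l, of h] l by (simp add: mult_left_mono)
qed

lemma resolvent_tendsto: "((\<lambda>l. resolvent l u) \<longlongrightarrow> u) (at_right 0)"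
proof (rule tendsto_contractions_of_dense[OF _ _ dense_G])
  show "\<forall>\<^sub>F l in at_right 0. linear (resolvent l)" "\<forall>\<^sub>F l in at_right 0. \<forall>u. norm (resolvent l u) \<le> norm u"
    by (auto simp: eventually_at_filter linear_resolvent norm_resolvent_le)
next
  fix u assume "u \<in> Domain G"
  then obtain h where h: "(u, h) \<in> G" by auto
  have "((\<lambda>l. l * norm h) \<longlongrightarrow> 0 * norm h) (at_right 0)" by (intro tendsto_intros)
  hence "((\<lambda>l. resolvent l u - u) \<longlongrightarrow> 0) (at_right 0)"
    using eventually_at_right_less[of "0::real"]
    by (intro Lim_null_comparison[where f = "\<lambda>l. resolvent l u - u" and g = "\<lambda>l. l * norm h"])
       (auto elim!: eventually_mono intro!: norm_resolvent_diff_le[OF h])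
  thus "((\<lambda>l. resolvent l u) \<longlongrightarrow> u) (at_right 0)" by (simp add: LIM_zero_iff)
qed

text \<open>The domain of \<open>G\<^sup>2\<close>, where the error of one resolvent step is quadratic in the step
size.\<close>

definition square_domain :: "'a set" where
  "square_domain = {f. \<exists>h k. (f, h) \<in> G \<and> (h, k) \<in> G}"

lemma resolvent_square_domain:
  assumes "(f, h) \<in> G" and l: "0 < l"
  shows "(resolvent l f, resolvent l h) \<in> G" "(resolvent l h, (h - resolvent l h) /\<^sub>R l) \<in> G"
  using resolvent_G[OF assms(1)] resolvent_in[OF l] l by auto

lemma dense_square_domain: "closure square_domain = UNIV"
proof -
  have "Domain G \<subseteq> closure square_domain"
  proof
    fix f assume "f \<in> Domain G"
    then obtain h where h: "(f, h) \<in> G" by auto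
    have "resolvent l f \<in> closure square_domain" if "0 < l" for l
      using resolvent_square_domain[OF h that] closure_subset[of square_domain]
        unfolding square_domain_def by blast
    hence "\<forall>\<^sub>F l in at_right (0::real). resolvent l f \<in> closure square_domain"
      by (simp add: eventually_at_filter)
    thus "f \<in> closure square_domain"
      by (rule Lim_in_closed_set[OF closed_closure _ trivial_limit_at_right_real resolvent_tendsto])
  qed
  hence "closure (Domain G) \<subseteq> closure square_domain" by (simp add: closure_minimal)
  thus ?thesis using dense_G by auto
qed

text \<open>The difference equals \<open>l m J\<^sub>l\<^sub>+\<^sub>m J\<^sub>l J\<^sub>m G\<^sup>2 f\<close>, since
\<open>(1 + l G)(1 + m G) = 1 + (l + m) G + l m G\<^sup>2\<close>. With \<open>l = m\<close> it compares one step of the Euler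
scheme with two half steps; with \<open>l\<close> and \<open>m\<close> proportional to two times it gives the semigroup
law.\<close>

lemma resolvent_add_approx:
  assumes fh: "(f, h) \<in> G" and hk: "(h, k) \<in> G" and l: "0 \<le> l" and m: "0 \<le> m"
  shows "norm (resolvent (l + m) f - resolvent l (resolvent m f)) \<le> l * m * norm k"
proof -
  define w w1 w2 where "w = resolvent l (resolvent m f)"
    and "w1 = resolvent l (resolvent m h)" and "w2 = resolvent l (resolvent m k)"
  have ww: "(w, w1) \<in> G" unfolding w_def w1_def by (intro resolvent_G fh l m)
  have d: "resolvent m f = w + l *\<^sub>R w1" "resolvent m h = w1 + l *\<^sub>R w2"
    unfolding w_def w1_def w2_def
      using resolvent_decomp[OF resolvent_G[OF fh m] l] resolvent_decomp[OF resolvent_G[OF hk m] l] by auto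
  have f: "f = (w + (l + m) *\<^sub>R w1) + (l * m) *\<^sub>R w2"
    using resolvent_decomp[OF fh m] unfolding d by (simp add: algebra_simps)
  have lin: "linear (resolvent (l + m))" using l m by (intro linear_resolvent) simp
  have "resolvent (l + m) f = resolvent (l + m) (w + (l + m) *\<^sub>R w1) + (l * m) *\<^sub>R resolvent (l + m) w2"
    by (subst f) (simp only: linear_add[OF lin] linear_scale[OF lin])
  also have "resolvent (l + m) (w + (l + m) *\<^sub>R w1) = w" using resolvent_eqI[OF ww] l m by simp
  finally have "norm (resolvent (l + m) f - w) = l * m * norm (resolvent (l + m) w2)"
    using l m by simp
  also have "norm (resolvent (l + m) w2) \<le> norm k"
    unfolding w2_def using l m by (meson add_nonneg_nonneg norm_resolvent_le order.trans)
  hence "l * m * norm (resolvent (l + m) w2) \<le> l * m * norm k"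
    using l m by (intro mult_left_mono) auto
  finally show ?thesis by (simp add: w_def)
qed

text \<open>Implicit Euler approximations of the semigroup. Doubling the number of steps makes
consecutive approximations comparable by a single application of the preceding lemma to each
step.\<close>

definition euler :: "nat \<Rightarrow> real \<Rightarrow> 'a \<Rightarrow> 'a" where
  "euler k t = resolvent (t / 2 ^ k) ^^ 2 ^ k"

lemma linear_euler: "0 \<le> t \<Longrightarrow> linear (euler k t)"
  unfolding euler_def by (intro linear_funpow linear_resolvent) simp

lemma norm_euler_le: "0 \<le> t \<Longrightarrow> norm (euler k t u) \<le> norm u"
  unfolding euler_def by (intro norm_funpow_le norm_resolvent_le) simp

lemma euler_step:
  assumes "(f, h) \<in> G" "(h, k) \<in> G" "0 \<le> t"
  shows "norm (euler (Suc n) t f - euler n t f) \<le> t\<^sup>2 / 4 * norm k * (1/2) ^ n"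
proof -
  define l where "l = t / 2 ^ Suc n"
  have l: "0 \<le> l" "l + l = t / 2 ^ n" using assms(3) by (auto simp: l_def)
  define R where "R = (\<lambda>u. resolvent l (resolvent l u))"
  have R: "linear R" "\<And>u. norm (R u) \<le> norm u"
    using linear_compose[OF linear_resolvent linear_resolvent, OF l(1) l(1)] norm_resolvent_le[OF l(1)]
    by (auto simp: R_def o_def intro: order.trans)
  have "euler (Suc n) t = (resolvent l ^^ 2) ^^ 2 ^ n"
    by (simp add: euler_def l_def funpow_mult mult.commute)
  also have "resolvent l ^^ 2 = R" by (simp add: R_def numeral_2_eq_2 o_def)
  finally have euler: "euler (Suc n) t f = (R ^^ 2 ^ n) f" by simp
  have euler': "euler n t f = (resolvent (l + l) ^^ 2 ^ n) f" by (simp add: euler_def l(2))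
  have "norm ((resolvent (l + l) ^^ 2 ^ n) f - (R ^^ 2 ^ n) f) \<le> real (2 ^ n) * (1 * norm (resolvent (l + l) f - R f))"
  proof (rule norm_funpow_diff_le)
    show "linear (resolvent (l + l))" using l(1) by (intro linear_resolvent) simp
    show "\<And>u. resolvent (l + l) (R u) = R (resolvent (l + l) u)"
      using l(1) by (simp add: R_def resolvent_resolvent)
    show "\<And>j u. norm ((resolvent (l + l) ^^ j) u) \<le> 1 * norm u"
      using norm_funpow_le[OF norm_resolvent_le[of "l + l"]] l(1) by simp
  qed (use R in auto)
  also have "\<dots> \<le> 2 ^ n * (l * l * norm k)"
    using resolvent_add_approx[OF assms(1,2) l(1) l(1)] by (simp add: R_def)
  also have "\<dots> = t\<^sup>2 / 4 * norm k * (1/2) ^ n"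
    by (simp add: l_def power2_eq_square power_one_over field_simps)
  finally show ?thesis by (simp add: euler euler' norm_minus_commute)
qed

lemma euler_convergent_square_domain:
  assumes "(f, h) \<in> G" "(h, k) \<in> G" "0 \<le> t"
  shows "convergent (\<lambda>n. euler n t f)" "norm (lim (\<lambda>n. euler n t f) - resolvent t f) \<le> t\<^sup>2 / 2 * norm k"
proof -
  let ?X = "\<lambda>n. euler n t f" and ?c = "t\<^sup>2 / 4 * norm k"
  have sg: "summable (\<lambda>n. ?c * (1/2) ^ n)" by (intro summable_mult summable_geometric) simp
  have sm: "summable (\<lambda>n. norm (?X (Suc n) - ?X n))"
    by (rule summable_comparison_test'[OF sg]) (use euler_step[OF assms] in simp)
  have E0: "?X 0 = resolvent t f" by (simp add: euler_def)
  have "(\<lambda>n. \<Sum>i<n. ?X (Suc i) - ?X i) \<longlonglongrightarrow> (\<Sum>i. ?X (Suc i) - ?X i)"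
    by (rule summable_LIMSEQ[OF summable_norm_cancel[OF sm]])
  hence "(\<lambda>n. ?X n - ?X 0) \<longlonglongrightarrow> (\<Sum>i. ?X (Suc i) - ?X i)"
    by (simp only: sum_lessThan_telescope[of ?X])
  hence *: "?X \<longlonglongrightarrow> (\<Sum>i. ?X (Suc i) - ?X i) + ?X 0"
    using tendsto_add[OF _ tendsto_const[of "?X 0"]] by fastforce
  thus "convergent ?X" by (auto simp: convergent_def)
  have "norm (lim ?X - resolvent t f) = norm (\<Sum>i. ?X (Suc i) - ?X i)"
    using limI[OF *] by (simp add: E0)
  also have "\<dots> \<le> (\<Sum>i. norm (?X (Suc i) - ?X i))" by (rule summable_norm[OF sm])
  also have "\<dots> \<le> (\<Sum>i. ?c * (1/2) ^ i)"
    by (rule suminf_le[OF _ sm sg]) (rule euler_step[OF assms])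
  also have "\<dots> = ?c * (\<Sum>i. (1/2) ^ i)" by (intro suminf_mult summable_geometric) simp
  also have "\<dots> = ?c * 2" by (simp add: suminf_geometric)
  finally show "norm (lim ?X - resolvent t f) \<le> t\<^sup>2 / 2 * norm k" by (simp add: mult.commute)
qed

definition flow :: "real \<Rightarrow> 'a \<Rightarrow> 'a" where
  "flow t f = lim (\<lambda>n. euler n t f)"

lemma euler_tendsto:
  assumes t: "0 \<le> t"
  shows "(\<lambda>n. euler n t f) \<longlonglongrightarrow> flow t f"
proof -
  have "convergent (\<lambda>n. euler n t f)"
  proof (rule convergent_contractions_of_dense[OF linear_euler[OF t] norm_euler_le[OF t] dense_square_domain])
    fix u assume "u \<in> square_domain"
    thus "convergent (\<lambda>n. euler n t u)"
      using euler_convergent_square_domain(1) t by (auto simp: square_domain_def)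
  qed
  thus ?thesis by (simp add: flow_def convergent_LIMSEQ_iff)
qed

lemma linear_flow:
  assumes t: "0 \<le> t"
  shows "linear (flow t)"
proof (rule linearI)
  fix u v
  have "(\<lambda>n. euler n t u + euler n t v) \<longlonglongrightarrow> flow t u + flow t v"
    by (intro tendsto_intros euler_tendsto t)
  hence "(\<lambda>n. euler n t (u + v)) \<longlonglongrightarrow> flow t u + flow t v"
    by (simp add: linear_add[OF linear_euler[OF t]])
  thus "flow t (u + v) = flow t u + flow t v" using LIMSEQ_unique euler_tendsto[OF t] by blast
next
  fix r u
  have "(\<lambda>n. r *\<^sub>R euler n t u) \<longlonglongrightarrow> r *\<^sub>R flow t u" by (intro tendsto_intros euler_tendsto t)
  hence "(\<lambda>n. euler n t (r *\<^sub>R u)) \<longlonglongrightarrow> r *\<^sub>R flow t u"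
    by (simp add: linear_scale[OF linear_euler[OF t]])
  thus "flow t (r *\<^sub>R u) = r *\<^sub>R flow t u" using LIMSEQ_unique euler_tendsto[OF t] by blast
qed

lemma norm_flow_le: "0 \<le> t \<Longrightarrow> norm (flow t u) \<le> norm u"
  by (rule LIMSEQ_le_const2[OF tendsto_norm[OF euler_tendsto]]) (auto intro: norm_euler_le)

lemma bounded_linear_flow: "0 \<le> t \<Longrightarrow> bounded_linear (flow t)"
  by (rule bounded_linear_intro[of _ 1])
    (auto simp: linear_add linear_scale linear_flow norm_flow_le)

lemma flow_0: "flow 0 u = u"
proof -
  have "euler n 0 u = u" for n
  proof -
    have "(resolvent 0 ^^ j) u = u" for j by (induction j) auto
    thus ?thesis by (simp add: euler_def)
  qed
  thus ?thesis using euler_tendsto[of 0 u] by (simp add: LIMSEQ_const_iff)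
qed

lemma flow_add_square_domain:
  assumes G: "(f, h) \<in> G" "(h, k) \<in> G" and s: "0 \<le> s" and t: "0 \<le> t"
  shows "flow (s + t) f = flow s (flow t f)"
proof -
  have bound: "norm (euler n (s + t) f - euler n s (euler n t f)) \<le> s * t * norm k * (1/2) ^ n"
    for n
  proof -
    define l m where "l = s / 2 ^ n" and "m = t / 2 ^ n"
    have lm: "0 \<le> l" "0 \<le> m" "(s + t) / 2 ^ n = l + m"
      using s t by (auto simp: l_def m_def add_divide_distrib)
    define R where "R = (\<lambda>u. resolvent l (resolvent m u))"
    have R: "linear R" "\<And>u. norm (R u) \<le> norm u"
      using linear_compose[OF linear_resolvent[OF lm(2)] linear_resolvent[OF lm(1)]] norm_resolvent_le[OF lm(1)] norm_resolvent_le[OF lm(2)]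
      by (auto simp: R_def o_def intro: order.trans)
    have Rpow: "(R ^^ j) u = (resolvent l ^^ j) ((resolvent m ^^ j) u)" for j u
    proof (induction j)
      case (Suc j)
      have sw: "resolvent m ((resolvent l ^^ j) v) = (resolvent l ^^ j) (resolvent m v)" for v
        by (induction j) (auto simp: resolvent_resolvent lm)
      show ?case using Suc sw by (simp add: R_def)
    qed simp
    have "norm ((resolvent (l + m) ^^ 2 ^ n) f - (R ^^ 2 ^ n) f) \<le> real (2 ^ n) * (1 * norm (resolvent (l + m) f - R f))"
    proof (rule norm_funpow_diff_le)
      show "linear (resolvent (l + m))" using lm by (intro linear_resolvent) simp
      show "\<And>u. resolvent (l + m) (R u) = R (resolvent (l + m) u)"
        using lm by (simp add: R_def resolvent_resolvent)
      show "\<And>j u. norm ((resolvent (l + m) ^^ j) u) \<le> 1 * norm u"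
        using norm_funpow_le[OF norm_resolvent_le[of "l + m"]] lm by simp
    qed (use R in auto)
    also have "\<dots> \<le> 2 ^ n * (l * m * norm k)"
      using resolvent_add_approx[OF G lm(1,2)] by (simp add: R_def)
    also have "\<dots> = s * t * norm k * (1/2) ^ n"
      by (simp add: l_def m_def power_one_over field_simps)
    finally show ?thesis using lm(3) by (simp add: euler_def Rpow l_def m_def)
  qed
  have "(\<lambda>n. s * t * norm k * (1/2) ^ n) \<longlonglongrightarrow> s * t * norm k * 0"
    by (intro tendsto_intros LIMSEQ_realpow_zero) auto
  hence 1: "(\<lambda>n. euler n (s + t) f - euler n s (euler n t f)) \<longlonglongrightarrow> 0"
    by (intro Lim_null_comparison[where f = "\<lambda>n. euler n (s + t) f - euler n s (euler n t f)"
          and g = "\<lambda>n. s * t * norm k * (1/2) ^ n"]) (use bound in auto)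
  have "(\<lambda>n. euler n t f - flow t f) \<longlonglongrightarrow> flow t f - flow t f"
    by (intro tendsto_intros euler_tendsto t)
  hence "(\<lambda>n. norm (euler n t f - flow t f)) \<longlonglongrightarrow> 0" using tendsto_norm by fastforce
  hence 2: "(\<lambda>n. euler n s (euler n t f - flow t f)) \<longlonglongrightarrow> 0"
    by (rule Lim_null_comparison[rotated]) (simp add: norm_euler_le s)
  have "(\<lambda>n. (euler n (s + t) f - euler n s (euler n t f)) + euler n s (euler n t f - flow t f) + euler n s (flow t f))
      \<longlonglongrightarrow> 0 + 0 + flow s (flow t f)"
    by (intro tendsto_add 1 2 euler_tendsto s)
  hence "(\<lambda>n. euler n (s + t) f) \<longlonglongrightarrow> flow s (flow t f)"
    by (simp add: linear_diff[OF linear_euler[OF s]])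
  thus ?thesis using LIMSEQ_unique euler_tendsto[of "s + t" f] s t by (metis add_nonneg_nonneg)
qed

lemma flow_add:
  assumes s: "0 \<le> s" and t: "0 \<le> t"
  shows "flow (s + t) f = flow s (flow t f)"
proof -
  have bl: "bounded_linear (\<lambda>f. flow (s + t) f - flow s (flow t f))"
    using s t
      by (intro bounded_linear_sub bounded_linear_compose[of "flow s" "flow t"] bounded_linear_flow) auto
  have "f \<in> closure square_domain" using dense_square_domain by simp
  moreover have "closed {f. flow (s + t) f - flow s (flow t f) = 0}"
    by (intro closed_Collect_eq continuous_intros bounded_linear.continuous_on[OF bl])
  moreover have "square_domain \<subseteq> {f. flow (s + t) f - flow s (flow t f) = 0}"
    using flow_add_square_domain s t by (auto simp: square_domain_def)
  ultimately have "flow (s + t) f - flow s (flow t f) = 0" using closure_minimal by blast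
  thus ?thesis by simp
qed

lemma norm_flow_diff_le:
  assumes "(f, h) \<in> G" and t: "0 \<le> t"
  shows "norm (flow t f - f) \<le> t * norm h"
proof -
  have "norm (euler n t f - f) \<le> t * norm h" for n
  proof -
    define l where "l = t / 2 ^ n"
    have l: "0 \<le> l" using t by (simp add: l_def)
    have "norm ((resolvent l ^^ 2 ^ n) f - ((\<lambda>u. u) ^^ 2 ^ n) f) \<le> real (2 ^ n) * (1 * norm (resolvent l f - f))"
      using norm_funpow_le[OF norm_resolvent_le[OF l]]
      by (intro norm_funpow_diff_le linear_resolvent l) (auto simp: linear_id[unfolded id_def])
    also have "\<dots> \<le> 2 ^ n * (l * norm h)" using norm_resolvent_diff_le[OF assms(1) l] by simp
    also have "\<dots> = t * norm h" by (simp add: l_def)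
    finally show ?thesis by (simp add: euler_def l_def id_def[symmetric])
  qed
  moreover have "(\<lambda>n. norm (euler n t f - f)) \<longlonglongrightarrow> norm (flow t f - f)"
    by (intro tendsto_intros euler_tendsto t)
  ultimately show ?thesis using LIMSEQ_le_const2 by blast
qed

lemma flow_tendsto: "((\<lambda>t. flow t u) \<longlongrightarrow> u) (at_right 0)"
proof (rule tendsto_contractions_of_dense[OF _ _ dense_G])
  show "\<forall>\<^sub>F t in at_right 0. linear (flow t)" "\<forall>\<^sub>F t in at_right 0. \<forall>u. norm (flow t u) \<le> norm u"
    by (auto simp: eventually_at_filter linear_flow norm_flow_le)
next
  fix u assume "u \<in> Domain G"
  then obtain h where h: "(u, h) \<in> G" by auto
  have "((\<lambda>l. l * norm h) \<longlongrightarrow> 0 * norm h) (at_right 0)" by (intro tendsto_intros)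
  hence "((\<lambda>t. flow t u - u) \<longlongrightarrow> 0) (at_right 0)"
    using eventually_at_right_less[of "0::real"]
    by (intro Lim_null_comparison[where f = "\<lambda>t. flow t u - u" and g = "\<lambda>l. l * norm h"])
       (auto elim!: eventually_mono intro!: norm_flow_diff_le[OF h])
  thus "((\<lambda>t. flow t u) \<longlongrightarrow> u) (at_right 0)" by (simp add: LIM_zero_iff)
qed

text \<open>On the domain of \<open>G\<^sup>2\<close> the difference quotient is controlled by comparison with a single
resolvent step. A general \<open>f\<close> in the domain of \<open>G\<close> is replaced by \<open>J\<^sub>l f\<close>; the error is
uniform in \<open>t\<close> because difference quotients are bounded by the norm of \<open>G f\<close>.\<close>

lemma flow_deriv:
  assumes G: "(f, h) \<in> G"
  shows "((\<lambda>t. (flow t f - f) /\<^sub>R t) \<longlongrightarrow> - h) (at_right 0)"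
proof (rule tendstoI)
  fix e :: real assume e: "e > 0"
  have "\<forall>\<^sub>F l in at_right (0::real). dist (resolvent l h) h < e/4 \<and> l > 0"
    using tendstoD[OF resolvent_tendsto[of h], of "e/4"] e
    by (auto simp: eventually_at_right_less intro: eventually_conj)
  then obtain l where l: "dist (resolvent l h) h < e/4" "0 < l"
    using eventually_happens' trivial_limit_at_right_real by blast
  define f' h' k where "f' = resolvent l f"
    and "h' = resolvent l h" and "k = (h - resolvent l h) /\<^sub>R l"
  have G': "(f', h') \<in> G" "(h', k) \<in> G"
    using resolvent_square_domain[OF G l(2)] by (auto simp: f'_def h'_def k_def)
  have hh: "norm (h - h') < e/4" using l(1) by (simp add: h'_def dist_norm norm_minus_commute)
  have est: "norm ((flow t f - f) /\<^sub>R t + h) \<le> norm (h - h') + 3/2 * t * norm k + norm (h - h')"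
    if t: "0 < t" for t
  proof -
    have t0: "0 \<le> t" using t by simp
    let ?a = "(flow t (f - f') - (f - f')) /\<^sub>R t" and ?b = "(flow t f' - resolvent t f') /\<^sub>R t"
      and ?c = "h' - resolvent t h'"
    have "norm ?a \<le> norm (h - h')"
      using norm_flow_diff_le[OF G_diff[OF G G'(1)] t0] t
      by (simp add: inverse_eq_divide pos_divide_le_eq mult.commute)
    moreover have "norm ?b \<le> t / 2 * norm k"
    proof -
      have "norm ?b = inverse t * norm (lim (\<lambda>n. euler n t f') - resolvent t f')"
        using t by (simp add: flow_def)
      also have "\<dots> \<le> inverse t * (t\<^sup>2 / 2 * norm k)"
        using t by (intro mult_left_mono euler_convergent_square_domain(2)[OF G' t0]) simp
      also have "\<dots> = t / 2 * norm k" using t by (simp add: power2_eq_square)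
      finally show ?thesis .
    qed
    moreover have "norm ?c \<le> t * norm k"
      using norm_resolvent_diff_le[OF G'(2) t0] by (simp add: norm_minus_commute)
    moreover have "resolvent t f' - f' = - (t *\<^sub>R resolvent t h')"
      using resolvent_decomp[OF G'(1) t0] by (simp add: algebra_simps)
    hence "(resolvent t f' - f') /\<^sub>R t = - resolvent t h'" using t by simp
    hence "(flow t f - f) /\<^sub>R t + h = ?a + ?b + ?c + (h - h')"
      by (simp add: linear_diff[OF linear_flow[OF t0]] scaleR_diff_right algebra_simps)
    ultimately show ?thesis
      using norm_triangle_ineq[of "?a + ?b + ?c" "h - h'"] norm_triangle_ineq[of "?a + ?b" ?c]
        norm_triangle_ineq[of ?a ?b] by simp
  qed
  have "((\<lambda>t. 3/2 * t * norm k) \<longlongrightarrow> 3/2 * 0 * norm k) (at_right 0)" by (intro tendsto_intros)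
  hence "\<forall>\<^sub>F t in at_right 0. 3/2 * t * norm k < e/2"
    using e by (intro order_tendstoD(2)[of _ 0]) auto
  moreover have "\<forall>\<^sub>F t in at_right (0::real). 0 < t" by (simp add: eventually_at_right_less)
  ultimately show "\<forall>\<^sub>F t in at_right 0. dist ((flow t f - f) /\<^sub>R t) (- h) < e"
  proof eventually_elim
    case (elim t)
    thus ?case using est[of t] hh by (simp add: dist_norm)
  qed
qed

text \<open>The generator of a contraction semigroup is dissipative and extends \<open>-G\<close>; since \<open>1 + G\<close>
is already onto, there is no room for a proper extension.\<close>

lemma flow_deriv_imp_G:
  assumes lim: "((\<lambda>t. (flow t f - f) /\<^sub>R t) \<longlongrightarrow> h) (at_right 0)"
  shows "(f, - h) \<in> G"
proof -
  obtain f' h' where G: "(f', h') \<in> G" and eq: "f' + 1 *\<^sub>R h' = f - h"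
    using range_G[of 1 "f - h"] by auto
  have "((\<lambda>t. (flow t f - f) /\<^sub>R t - (flow t f' - f') /\<^sub>R t) \<longlongrightarrow> h - (- h')) (at_right 0)"
    by (intro tendsto_diff lim flow_deriv G)
  moreover have "h - (- h') = f - f'" using eq by (simp add: algebra_simps)
  ultimately have "((\<lambda>t. (flow t f - f) /\<^sub>R t - (flow t f' - f') /\<^sub>R t) \<longlongrightarrow> f - f') (at_right 0)"
    by (simp only:)
  hence "((\<lambda>t. inner (f - f') ((flow t f - f) /\<^sub>R t - (flow t f' - f') /\<^sub>R t)) \<longlongrightarrow> inner (f - f') (f - f')) (at_right 0)"
    by (rule tendsto_inner[OF tendsto_const])
  moreover have "\<forall>\<^sub>F t in at_right 0. inner (f - f') ((flow t f - f) /\<^sub>R t - (flow t f' - f') /\<^sub>R t) \<le> 0"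
  proof -
    have "inner (f - f') ((flow t f - f) /\<^sub>R t - (flow t f' - f') /\<^sub>R t) \<le> 0" if t: "0 < t" for t
    proof -
      define d where "d = f - f'"
      have "inner d (flow t d) \<le> norm d * norm (flow t d)" by (rule norm_cauchy_schwarz)
      also have "\<dots> \<le> norm d * norm d" using t by (intro mult_left_mono norm_flow_le) auto
      finally have "inner d (flow t d - d) \<le> 0"
        by (simp add: inner_diff_right dot_square_norm power2_eq_square)
      hence "inverse t * inner d (flow t d - d) \<le> 0" using t by (simp add: mult_nonneg_nonpos)
      moreover have "(flow t f - f) /\<^sub>R t - (flow t f' - f') /\<^sub>R t = (flow t d - d) /\<^sub>R t"
        using t by (simp add: d_def linear_diff[OF linear_flow] algebra_simps)
      ultimately show ?thesis by (simp add: d_def)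
    qed
    thus ?thesis by (simp add: eventually_at_filter)
  qed
  ultimately have "inner (f - f') (f - f') \<le> 0"
    using tendsto_upperbound trivial_limit_at_right_real by blast
  hence "f = f'" using inner_self_le_0D[of "f - f'"] by simp
  thus ?thesis using G eq by simp
qed

end

definition semigroup_generator :: "(real \<Rightarrow> 'a::real_normed_vector \<Rightarrow> 'a) \<Rightarrow> ('a \<times> 'a) set" where
  "semigroup_generator T = {(f, h). ((\<lambda>t. (T t f - f) /\<^sub>R t) \<longlongrightarrow> h) (at_right 0)}"

locale C0_semigroup_banach =
  fixes T :: "real \<Rightarrow> 'a::banach \<Rightarrow> 'a"
  assumes bounded_linear_T: "0 \<le> t \<Longrightarrow> bounded_linear (T t)"
    and T_0: "T 0 f = f"
    and T_add: "0 \<le> s \<Longrightarrow> 0 \<le> t \<Longrightarrow> T (s + t) f = T s (T t f)"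
    and T_tendsto: "((\<lambda>t. T t f) \<longlongrightarrow> f) (at_right 0)"
begin

text \<open>Otherwise there are times \<open>t\<^sub>n \<rightarrow> 0\<close> at which the operator norms grow faster than \<open>4\<^sup>n\<close>,
and the gliding hump yields a vector with unbounded orbit, contradicting strong continuity.\<close>

lemma bounded_near_0: "\<exists>d>0. \<exists>M\<ge>1. \<forall>t. 0 \<le> t \<and> t \<le> d \<longrightarrow> onorm (T t) \<le> M"
proof (rule ccontr)
  assume *: "\<not> ?thesis"
  have "\<exists>t. 0 \<le> t \<and> t \<le> 1 / real (Suc n) \<and> onorm (T t) > 4 ^ n" for n :: nat
  proof (rule ccontr)
    assume "\<not> ?thesis"
    hence "\<forall>t. 0 \<le> t \<and> t \<le> 1 / real (Suc n) \<longrightarrow> onorm (T t) \<le> 4 ^ n" by force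
    moreover have "0 < 1 / real (Suc n)" "(1::real) \<le> 4 ^ n" by auto
    ultimately show False using * by blast
  qed
  then obtain t where t: "\<And>n::nat. 0 \<le> t n" "\<And>n. t n \<le> 1 / real (Suc n)"
    "\<And>n. onorm (T (t n)) > 4 ^ n" by metis
  have t0: "t \<longlonglongrightarrow> 0"
    by (rule tendsto_sandwich[OF _ _ tendsto_const LIMSEQ_Suc[OF lim_1_over_n]])
       (use t in \<open>auto intro: always_eventually\<close>)
  obtain x where x: "\<not> Bseq (\<lambda>n. T (t n) x)"
    using gliding_hump[of "\<lambda>n. T (t n)"] bounded_linear_T t(1,3) by blast
  have "continuous (at_right 0) (\<lambda>t. T t x)"
    using T_tendsto[of x] by (simp add: continuous_within T_0)
  hence "((\<lambda>s. T s x) \<longlongrightarrow> x) (at 0 within {0..})"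
    using T_tendsto[of x] by (simp add: at_within_Ici_at_right)
  hence "(\<lambda>n. T (t n) x) \<longlonglongrightarrow> x"
    unfolding tendsto_def eventually_at_topological
    using t0 t(1) T_0 by (smt (verit) atLeast_iff eventually_mono topological_tendstoD)
  thus False using x convergent_imp_Bseq convergent_def by blast
qed

lemma onorm_T_add:
  assumes "0 \<le> s" "0 \<le> t"
  shows "onorm (T (s + t)) \<le> onorm (T s) * onorm (T t)"
proof -
  have "T (s + t) = T s \<circ> T t" by (rule ext) (simp add: T_add assms)
  thus ?thesis using onorm_compose[OF bounded_linear_T bounded_linear_T] assms by simp
qed

lemma locally_bounded:
  assumes t: "0 \<le> t"
  shows "\<exists>M\<ge>1. \<forall>s. 0 \<le> s \<and> s \<le> t \<longrightarrow> onorm (T s) \<le> M"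
proof -
  obtain d M where d: "d > 0" and M: "M \<ge> 1" "\<And>t. 0 \<le> t \<Longrightarrow> t \<le> d \<Longrightarrow> onorm (T t) \<le> M"
    using bounded_near_0 by blast
  have *: "onorm (T s) \<le> M ^ Suc n" if "0 \<le> s" "s \<le> real (Suc n) * d" for n s
    using that
  proof (induction n arbitrary: s)
    case 0
    thus ?case using M by simp
  next
    case (Suc n)
    show ?case
    proof (cases "s \<le> d")
      case True
      have "M \<le> M ^ Suc (Suc n)" using M(1) by (rule self_le_power) simp
      thus ?thesis using M(2)[of s] True Suc.prems by linarith
    next
      case False
      have "onorm (T (d + (s - d))) \<le> onorm (T d) * onorm (T (s - d))"
        using False d by (intro onorm_T_add) auto
      also have "\<dots> \<le> M * M ^ Suc n"
        using M d Suc.prems False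
        by (intro mult_mono Suc.IH onorm_pos_le bounded_linear_T) (auto simp: algebra_simps)
      finally show ?thesis by simp
    qed
  qed
  obtain n :: nat where "t / d \<le> real n" using real_arch_simple by blast
  hence "t \<le> real (Suc n) * d" using d by (simp add: field_simps)
  moreover have "1 \<le> M ^ Suc n" using M(1) by (rule one_le_power)
  ultimately show ?thesis using * by (intro exI[of _ "M ^ Suc n"]) auto
qed

lemma T_commute: "0 \<le> s \<Longrightarrow> 0 \<le> t \<Longrightarrow> T s (T t f) = T t (T s f)"
  by (metis T_add add.commute)

lemma T_generator:
  assumes "(f, h) \<in> semigroup_generator T" and t: "0 \<le> t"
  shows "(T t f, T t h) \<in> semigroup_generator T"
proof -
  have "((\<lambda>s. T t ((T s f - f) /\<^sub>R s)) \<longlongrightarrow> T t h) (at_right 0)"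
    using assms
      by (intro bounded_linear.tendsto[OF bounded_linear_T]) (auto simp: semigroup_generator_def)
  moreover have "\<forall>\<^sub>F s in at_right 0. T t ((T s f - f) /\<^sub>R s) = (T s (T t f) - T t f) /\<^sub>R s"
  proof -
    have "T t ((T s f - f) /\<^sub>R s) = (T s (T t f) - T t f) /\<^sub>R s" if "0 < s" for s
      using bounded_linear.linear[OF bounded_linear_T[OF t]] that t
      by (simp add: linear_diff linear_scale T_commute)
    thus ?thesis by (simp add: eventually_at_filter)
  qed
  ultimately show ?thesis unfolding semigroup_generator_def
    by (auto elim: Lim_transform_eventually)
qed

end

context maximal_monotone
begin

lemma generator_flow: "(f, h) \<in> semigroup_generator flow \<longleftrightarrow> (f, - h) \<in> G"
  using flow_deriv[of f "- h"] flow_deriv_imp_G[of f h] by (auto simp: semigroup_generator_def)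

text \<open>The Euler formula holds for every semigroup with generator \<open>-G\<close>, which makes the
semigroup unique. For \<open>f\<close> in the domain both \<open>T s f\<close> and \<open>J\<^sub>s f\<close> have derivative \<open>-G f\<close> at \<open>0\<close>, so one
step of size \<open>t/n\<close> has error \<open>o(t/n)\<close>; telescoping over \<open>n\<close> steps needs only that \<open>T\<close> is
bounded on \<open>[0,t]\<close>.\<close>

lemma semigroup_approx:
  assumes T: "C0_semigroup_banach T" and gen: "\<And>f h. (f, h) \<in> semigroup_generator T \<longleftrightarrow> (f, - h) \<in> G"
    and t: "0 < t" and G: "(f, h) \<in> G"
  shows "(\<lambda>n. (resolvent (t / real (Suc n)) ^^ Suc n) f) \<longlonglongrightarrow> T t f"
proof -
  interpret C0_semigroup_banach T by (rule T)
  obtain M where M: "M \<ge> 1" "\<And>s. 0 \<le> s \<Longrightarrow> s \<le> t \<Longrightarrow> onorm (T s) \<le> M"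
    using locally_bounded[of t] t by auto
  define d where "d s = (T s f - f) /\<^sub>R s - (resolvent s f - f) /\<^sub>R s" for s
  have "((\<lambda>s. (T s f - f) /\<^sub>R s) \<longlongrightarrow> - h) (at_right 0)"
    using gen[of f "- h"] G by (simp add: semigroup_generator_def)
  moreover have "((\<lambda>s. (resolvent s f - f) /\<^sub>R s) \<longlongrightarrow> - h) (at_right 0)"
  proof (rule Lim_transform_eventually)
    show "((\<lambda>s. - resolvent s h) \<longlongrightarrow> - h) (at_right 0)" by (intro tendsto_intros resolvent_tendsto)
    have "- resolvent s h = (resolvent s f - f) /\<^sub>R s" if s: "0 < s" for s
    proof -
      have "resolvent s f - f = - (s *\<^sub>R resolvent s h)"
        using resolvent_decomp[OF G, of s] s by (simp add: algebra_simps)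
      thus ?thesis using s by simp
    qed
    thus "\<forall>\<^sub>F s in at_right 0. - resolvent s h = (resolvent s f - f) /\<^sub>R s"
      by (simp add: eventually_at_filter)
  qed
  ultimately have "(d \<longlongrightarrow> - h - - h) (at_right 0)" unfolding d_def by (rule tendsto_diff)
  hence d0: "((\<lambda>s. t * (M * norm (d s))) \<longlongrightarrow> 0) (at_right 0)"
    using tendsto_mult[OF tendsto_const[of t] tendsto_mult[OF tendsto_const[of M] tendsto_norm]] by fastforce
  have lim: "filterlim (\<lambda>n. t / real (Suc n)) (at_right 0) sequentially"
    using t tendsto_mult[OF tendsto_const[of t] LIMSEQ_Suc[OF lim_1_over_n]]
    by (intro filterlim_at_withinI) (auto intro!: always_eventually)
  have bound: "norm ((resolvent (t / real (Suc n)) ^^ Suc n) f - T t f) \<le> t * (M * norm (d (t / real (Suc n))))"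
    for n
  proof -
    define s where "s = t / real (Suc n)"
    have s: "0 < s" "real (Suc n) * s = t" using t by (auto simp: s_def)
    have lin: "linear (T s)" using bounded_linear.linear[OF bounded_linear_T] s by simp
    have Tpow: "(T s ^^ j) u = T (real j * s) u" for j u
    proof (induction j)
      case (Suc j)
      thus ?case using T_add[of s "real j * s" u] s by (simp add: algebra_simps)
    qed (simp add: T_0)
    have "norm ((T s ^^ Suc n) f - (resolvent s ^^ Suc n) f) \<le> real (Suc n) * (M * norm (T s f - resolvent s f))"
    proof (rule norm_funpow_diff_le)
      show "\<And>u. T s (resolvent s u) = resolvent s (T s u)"
      proof (rule resolvent_commute[OF lin])
        fix f h assume "(f, h) \<in> G"
        hence "(f, - h) \<in> semigroup_generator T" by (simp add: gen)
        from T_generator[OF this, of s] s have "(T s f, T s (- h)) \<in> semigroup_generator T"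
          by simp
        thus "(T s f, T s h) \<in> G" by (simp add: gen linear_neg[OF lin])
      qed (use s in simp)
      fix j u assume j: "j < Suc n"
      have "real j * s \<le> real (Suc n) * s" using j s by (intro mult_right_mono) auto
      hence "real j * s \<le> t" by (simp only: s(2))
      hence "onorm (T (real j * s)) \<le> M" using M(2) s by simp
      thus "norm ((T s ^^ j) u) \<le> M * norm u"
        unfolding Tpow using s
        by (intro order.trans[OF onorm[OF bounded_linear_T] mult_right_mono]) auto
    qed (use lin linear_resolvent norm_resolvent_le s in auto)
    also have "T s f - resolvent s f = s *\<^sub>R d s" using s by (simp add: d_def algebra_simps)
    hence "real (Suc n) * (M * norm (T s f - resolvent s f)) = real (Suc n) * s * (M * norm (d s))"
      using s by simp
    finally show ?thesis
      unfolding Tpow s(2) s_def[symmetric] by (subst norm_minus_commute)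
  qed
  have "(\<lambda>n. (resolvent (t / real (Suc n)) ^^ Suc n) f - T t f) \<longlonglongrightarrow> 0"
    by (rule Lim_null_comparison[OF always_eventually filterlim_compose[OF d0 lim]]) (use bound in blast)
  thus ?thesis by (simp add: LIM_zero_iff)
qed

lemma semigroup_commute:
  assumes T: "C0_semigroup_banach T" and gen: "\<And>f h. (f, h) \<in> semigroup_generator T \<longleftrightarrow> (f, - h) \<in> G"
    and A: "bounded_linear A" and inv: "\<And>f h. (f, h) \<in> G \<Longrightarrow> (A f, A h) \<in> G" and t: "0 \<le> t"
  shows "A (T t f) = T t (A f)"
proof (cases "t = 0")
  case True
  thus ?thesis using T by (simp add: C0_semigroup_banach.T_0)
next
  case False
  hence t: "t > 0" using t by simp
  have blT: "bounded_linear (T t)" using T t by (simp add: C0_semigroup_banach.bounded_linear_T)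
  have bl: "bounded_linear (\<lambda>f. A (T t f) - T t (A f))"
    by (intro bounded_linear_sub bounded_linear_compose[OF A blT] bounded_linear_compose[OF blT A])
  have "A (T t f) - T t (A f) = 0" if f: "f \<in> Domain G" for f
  proof -
    obtain h where h: "(f, h) \<in> G" using f by auto
    have pow: "A ((resolvent s ^^ n) u) = (resolvent s ^^ n) (A u)" if "0 \<le> s" for s n u
      by (induction n) (auto simp: resolvent_commute[OF bounded_linear.linear[OF A] inv that])
    have "(\<lambda>n. A ((resolvent (t / real (Suc n)) ^^ Suc n) f)) \<longlonglongrightarrow> A (T t f)"
      by (intro bounded_linear.tendsto[OF A] semigroup_approx[OF T gen t h])
    hence "(\<lambda>n. (resolvent (t / real (Suc n)) ^^ Suc n) (A f)) \<longlonglongrightarrow> A (T t f)"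
      using t by (simp add: pow del: funpow.simps)
    moreover have "(\<lambda>n. (resolvent (t / real (Suc n)) ^^ Suc n) (A f)) \<longlonglongrightarrow> T t (A f)"
      by (rule semigroup_approx[OF T gen t inv[OF h]])
    ultimately show ?thesis using LIMSEQ_unique by force
  qed
  hence "Domain G \<subseteq> {f. A (T t f) - T t (A f) = 0}" by auto
  moreover have "closed {f. A (T t f) - T t (A f) = 0}"
    by (intro closed_Collect_eq continuous_intros bounded_linear.continuous_on[OF bl])
  ultimately have "closure (Domain G) \<subseteq> {f. A (T t f) - T t (A f) = 0}" by (rule closure_minimal)
  thus ?thesis using dense_G by auto
qed

end

section \<open>The Hilbert space of square-summable functions\<close>

definition sq_summable :: "('i \<Rightarrow> real) \<Rightarrow> bool" where
  "sq_summable f \<longleftrightarrow> (\<lambda>x. (f x)\<^sup>2) summable_on UNIV"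

lemma sq_summable_mult:
  assumes "sq_summable f" "sq_summable g"
  shows "(\<lambda>x. f x * g x) summable_on UNIV"
proof (rule abs_summable_summable, rule summable_on_comparison_test)
  show "(\<lambda>x. (f x)\<^sup>2 + (g x)\<^sup>2) summable_on UNIV"
    using assms unfolding sq_summable_def by (rule summable_on_add)
  fix x
  have "0 \<le> (\<bar>f x\<bar> - \<bar>g x\<bar>)\<^sup>2" by simp
  hence "2 * (\<bar>f x\<bar> * \<bar>g x\<bar>) \<le> (f x)\<^sup>2 + (g x)\<^sup>2" by (simp add: power2_diff)
  moreover have "0 \<le> \<bar>f x\<bar> * \<bar>g x\<bar>" by simp
  ultimately show "norm (f x * g x) \<le> (f x)\<^sup>2 + (g x)\<^sup>2"
    unfolding real_norm_def abs_mult by linarith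
qed simp

lemma sq_summable_add:
  assumes "sq_summable f" "sq_summable g"
  shows "sq_summable (\<lambda>x. f x + g x)"
proof -
  have "(\<lambda>x. (f x)\<^sup>2 + (2 * (f x * g x) + (g x)\<^sup>2)) summable_on UNIV"
    using assms sq_summable_mult[OF assms] unfolding sq_summable_def
    by (intro summable_on_add summable_on_cmult_right)
  thus ?thesis by (simp add: sq_summable_def power2_sum algebra_simps)
qed

lemma sq_summable_scale: "sq_summable f \<Longrightarrow> sq_summable (\<lambda>x. a * f x)"
  unfolding sq_summable_def power_mult_distrib by (rule summable_on_cmult_right)

lemma sq_summable_minus: "sq_summable f \<Longrightarrow> sq_summable (\<lambda>x. - f x)"
  by (simp add: sq_summable_def)

lemma sq_summable_diff: "sq_summable f \<Longrightarrow> sq_summable g \<Longrightarrow> sq_summable (\<lambda>x. f x - g x)"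
  using sq_summable_add[OF _ sq_summable_minus, of f g] by simp

lemma sq_summable_finite_support:
  assumes "finite {x. f x \<noteq> 0}"
  shows "sq_summable f"
proof -
  have "(\<lambda>x. (f x)\<^sup>2) summable_on {x. f x \<noteq> 0}" using assms by (rule summable_on_finite)
  thus ?thesis
    unfolding sq_summable_def by (subst summable_on_cong_neutral[where T = "{x. f x \<noteq> 0}"]) auto
qed

lemma sq_summable_0: "sq_summable (\<lambda>x. 0)"
  by (rule sq_summable_finite_support) simp

text \<open>The unweighted space, so that it does not depend on the term \<open>m\<close> and can be a type, an
instance of the Hilbert space classes. The weight enters through multiplication by its square
root.\<close>

typedef 'i l2 = "{f :: 'i \<Rightarrow> real. sq_summable f}"
  morphisms coord l2_of
  using sq_summable_0 by blast

lemma sq_summable_coord: "sq_summable (coord u)"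
  using coord[of u] by simp

lemma coord_l2_of: "sq_summable f \<Longrightarrow> coord (l2_of f) = f"
  by (simp add: l2_of_inverse)

lemma l2_eqI: "(\<And>x. coord u x = coord v x) \<Longrightarrow> u = v"
  using coord_inject by blast

instantiation l2 :: (type) real_vector
begin

definition zero_l2 :: "'a l2" where "0 = l2_of (\<lambda>x. 0)"
definition plus_l2 :: "'a l2 \<Rightarrow> 'a l2 \<Rightarrow> 'a l2" where "u + v = l2_of (\<lambda>x. coord u x + coord v x)"
definition scaleR_l2 :: "real \<Rightarrow> 'a l2 \<Rightarrow> 'a l2" where "r *\<^sub>R u = l2_of (\<lambda>x. r * coord u x)"
definition uminus_l2 :: "'a l2 \<Rightarrow> 'a l2" where "- u = (- 1) *\<^sub>R (u :: 'a l2)"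
definition minus_l2 :: "'a l2 \<Rightarrow> 'a l2 \<Rightarrow> 'a l2" where "u - v = u + - (v :: 'a l2)"

lemma coord_simps:
  "coord 0 x = 0"
  "coord (u + v) x = coord u x + coord v x"
  "coord (r *\<^sub>R u) x = r * coord u x"
  "coord (- u) x = - coord u x"
  "coord (u - v) x = coord u x - coord v x"
  by (simp_all add: zero_l2_def plus_l2_def scaleR_l2_def uminus_l2_def minus_l2_def coord_l2_of
      sq_summable_0 sq_summable_coord sq_summable_add sq_summable_scale sq_summable_minus
      sq_summable_diff)

instance
  by standard (rule l2_eqI, simp add: coord_simps algebra_simps)+

end

lemmas coord_l2 [simp] = coord_simps

instantiation l2 :: (type) real_inner
begin

definition inner_l2 :: "'a l2 \<Rightarrow> 'a l2 \<Rightarrow> real" where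
  "inner u v = (\<Sum>\<^sub>\<infinity>x. coord u x * coord v x)"
definition norm_l2 :: "'a l2 \<Rightarrow> real" where "norm u = sqrt (inner u (u :: 'a l2))"
definition dist_l2 :: "'a l2 \<Rightarrow> 'a l2 \<Rightarrow> real" where "dist u v = norm (u - v :: 'a l2)"
definition sgn_l2 :: "'a l2 \<Rightarrow> 'a l2" where "sgn u = u /\<^sub>R norm (u :: 'a l2)"
definition uniformity_l2 :: "('a l2 \<times> 'a l2) filter" where
  "uniformity_l2 = (INF e\<in>{0 <..}. principal {(u, v). dist u (v :: 'a l2) < e})"
definition open_l2 :: "'a l2 set \<Rightarrow> bool" where
  "open_l2 U \<longleftrightarrow> (\<forall>u\<in>U. eventually (\<lambda>(u', v). u' = u \<longrightarrow> v \<in> U) (uniformity :: ('a l2 \<times> 'a l2) filter))"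

instance
proof
  fix u v w :: "'a l2" and r :: real
  note sm = sq_summable_mult[OF sq_summable_coord sq_summable_coord]
  show "inner u v = inner v u" by (simp add: inner_l2_def mult.commute)
  show "inner (u + v) w = inner u w + inner v w"
    unfolding inner_l2_def coord_l2 distrib_right by (rule infsum_add[OF sm sm])
  show "inner (r *\<^sub>R u) v = r * inner u v"
    unfolding inner_l2_def coord_l2 mult.assoc by (rule infsum_cmult_right')
  show "0 \<le> inner u u" unfolding inner_l2_def by (rule infsum_nonneg) simp
  show "inner u u = 0 \<longleftrightarrow> u = 0"
  proof
    assume "inner u u = 0"
    hence "coord u x * coord u x = 0" for x
      unfolding inner_l2_def by (rule nonneg_infsum_le_0D[OF eq_refl sm]) auto
    thus "u = 0" by (intro l2_eqI) simp
  qed (simp add: inner_l2_def)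
qed (simp_all add: norm_l2_def dist_l2_def sgn_l2_def uniformity_l2_def open_l2_def)

end

lemma inner_l2_finite:
  assumes "finite F" "\<And>x. x \<notin> F \<Longrightarrow> coord u x * coord v x = 0"
  shows "inner u v = (\<Sum>x\<in>F. coord u x * coord v x)"
proof -
  have "inner u v = (\<Sum>\<^sub>\<infinity>x\<in>F. coord u x * coord v x)"
    unfolding inner_l2_def by (rule infsum_cong_neutral) (use assms in auto)
  thus ?thesis using assms(1) by simp
qed

lemma sum_coord_le_norm:
  assumes "finite F"
  shows "(\<Sum>x\<in>F. (coord u x)\<^sup>2) \<le> (norm u)\<^sup>2"
  unfolding power2_norm_eq_inner inner_l2_def power2_eq_square[of "coord u _"]
  by (rule finite_sum_le_infsum[OF sq_summable_mult[OF sq_summable_coord sq_summable_coord] assms]) auto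

lemma coord_le_norm: "\<bar>coord u x\<bar> \<le> norm u"
  using sum_coord_le_norm[of "{x}" u] abs_le_square_iff[of "coord u x" "norm u"] by simp

lemma bounded_linear_coord: "bounded_linear (\<lambda>u. coord u x)"
  by (rule bounded_linear_intro[of _ 1]) (auto simp: coord_le_norm)

lemmas tendsto_coord [tendsto_intros] = bounded_linear.tendsto[OF bounded_linear_coord]

lemma sq_summableI:
  assumes "\<And>F. finite F \<Longrightarrow> (\<Sum>x\<in>F. (f x)\<^sup>2) \<le> K"
  shows "sq_summable f"
  unfolding sq_summable_def
  by (rule nonneg_bdd_above_summable_on) (use assms in \<open>auto simp: bdd_above_def\<close>)

lemma norm_le_of_sums:
  assumes "\<And>F. finite F \<Longrightarrow> (\<Sum>x\<in>F. (coord u x)\<^sup>2) \<le> K\<^sup>2" "0 \<le> K"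
  shows "norm u \<le> K"
proof -
  have "(norm u)\<^sup>2 \<le> K\<^sup>2"
    unfolding power2_norm_eq_inner inner_l2_def
    by (rule infsum_le_finite_sums[OF sq_summable_mult[OF sq_summable_coord sq_summable_coord]])
       (use assms(1) in \<open>simp only: power2_eq_square\<close>)
  thus ?thesis using assms(2) by (rule power2_le_imp_le)
qed

instance l2 :: (type) banach
proof
  fix X :: "nat \<Rightarrow> 'a l2"
  assume X: "Cauchy X"
  have "convergent (\<lambda>n. coord (X n) x)" for x
    by (rule Cauchy_convergent[OF bounded_linear.Cauchy[OF bounded_linear_coord X]])
  then obtain f where f: "\<And>x. (\<lambda>n. coord (X n) x) \<longlonglongrightarrow> f x"
    unfolding convergent_def by metis
  obtain K where K: "\<And>n. norm (X n) \<le> K"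
    using cauchy_imp_bounded[OF X] by (auto simp: bounded_iff)
  have K2: "(norm (X n))\<^sup>2 \<le> K\<^sup>2" for n using K[of n] by (intro power_mono) auto
  have sf: "sq_summable f"
  proof (rule sq_summableI)
    fix F :: "'a set" assume F: "finite F"
    have "(\<lambda>n. \<Sum>x\<in>F. (coord (X n) x)\<^sup>2) \<longlonglongrightarrow> (\<Sum>x\<in>F. (f x)\<^sup>2)"
      by (intro tendsto_intros f)
    thus "(\<Sum>x\<in>F. (f x)\<^sup>2) \<le> K\<^sup>2"
      by (rule LIMSEQ_le_const2) (use sum_coord_le_norm[OF F] K2 order.trans in blast)
  qed
  have "X \<longlonglongrightarrow> l2_of f"
  proof (rule LIMSEQ_I)
    fix r :: real assume r: "r > 0"
    obtain N where N: "\<And>i j. i \<ge> N \<Longrightarrow> j \<ge> N \<Longrightarrow> norm (X i - X j) < r/2"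
      using CauchyD[OF X, of "r/2"] r by auto
    have "norm (X i - l2_of f) \<le> r/2" if i: "i \<ge> N" for i
    proof (rule norm_le_of_sums)
      fix F :: "'a set" assume F: "finite F"
      have "(\<lambda>j. \<Sum>x\<in>F. (coord (X i) x - coord (X j) x)\<^sup>2) \<longlonglongrightarrow> (\<Sum>x\<in>F. (coord (X i) x - f x)\<^sup>2)"
        by (intro tendsto_intros f)
      moreover have "(\<Sum>x\<in>F. (coord (X i) x - coord (X j) x)\<^sup>2) \<le> (r/2)\<^sup>2" if j: "j \<ge> N" for j
      proof -
        have "(\<Sum>x\<in>F. (coord (X i) x - coord (X j) x)\<^sup>2) \<le> (norm (X i - X j))\<^sup>2"
          using sum_coord_le_norm[OF F, of "X i - X j"] by simp
        also have "\<dots> \<le> (r/2)\<^sup>2" using N[OF i j] by (intro power_mono) auto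
        finally show ?thesis .
      qed
      ultimately have "(\<Sum>x\<in>F. (coord (X i) x - f x)\<^sup>2) \<le> (r/2)\<^sup>2"
        using LIMSEQ_le_const2 by blast
      thus "(\<Sum>x\<in>F. (coord (X i - l2_of f) x)\<^sup>2) \<le> (r/2)\<^sup>2" by (simp add: coord_l2_of[OF sf])
    qed (use r in simp)
    thus "\<exists>N. \<forall>n\<ge>N. norm (X n - l2_of f) < r" using r by (intro exI[of _ N]) force
  qed
  thus "convergent X" by (auto simp: convergent_def)
qed

definition unit_vec :: "'i \<Rightarrow> 'i l2" where
  "unit_vec x = l2_of (\<lambda>y. if y = x then 1 else 0)"

lemma coord_unit_vec: "coord (unit_vec x) y = (if y = x then 1 else 0)"
  by (simp add: unit_vec_def coord_l2_of sq_summable_finite_support)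

lemma inner_unit_vec: "inner u (unit_vec x) = coord u x"
  by (subst inner_l2_finite[where F = "{x}"]) (auto simp: coord_unit_vec)

text \<open>The orthogonal complement of the unit vectors is zero, since inner products with them
are coordinates.\<close>

lemma dense_subspace_l2:
  assumes "subspace M" and "\<And>x. unit_vec x \<in> M"
  shows "closure M = UNIV"
proof -
  have "u \<in> closure M" for u
  proof -
    obtain p where p: "p \<in> closure M" "\<forall>v\<in>closure M. inner (u - p) v = 0"
      using orthogonal_projection_exists[OF subspace_closure[OF assms(1)] closed_closure] by blast
    have "coord (u - p) x = 0" for x
      using p(2) assms(2)[of x] closure_subset[of M] by (metis inner_unit_vec subsetD)
    hence "u = p" by (intro l2_eqI) simp
    thus ?thesis using p(1) by simp
  qed
  thus ?thesis by blast
qed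

section \<open>The form and its operator\<close>

lemma pair_l2_eqI:
  fixes k l :: "('i \<times> 'i) l2 \<times> 'j l2"
  assumes "\<And>x y. coord (fst k) (x, y) = coord (fst l) (x, y)" "\<And>x. coord (snd k) x = coord (snd l) x"
  shows "k = l"
proof (rule prod_eqI)
  show "fst k = fst l"
  proof (rule l2_eqI)
    fix z show "coord (fst k) z = coord (fst l) z" using assms(1) by (cases z) simp
  qed
qed (rule l2_eqI, rule assms(2))

locale lf_graph = weighted_graph b c m
  for b :: "'v \<Rightarrow> 'v \<Rightarrow> real" and c :: "'v \<Rightarrow> real" and m :: "'v \<Rightarrow> real" +
  assumes connected: "graph_connected b" and locally_finite: "locally_finite_graph b"
begin

lemma m_nonneg: "0 \<le> m x" using m_pos[of x] by simp

lemma m_neq_0: "m x \<noteq> 0" using m_pos[of x] by simp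

lemma finite_neighbors: "finite {y. 0 < b x y}"
  using locally_finite by (simp add: locally_finite_graph_def)

definition to_l2 :: "('v \<Rightarrow> real) \<Rightarrow> 'v l2" where
  "to_l2 f = l2_of (\<lambda>x. f x * sqrt (m x))"

definition of_l2 :: "'v l2 \<Rightarrow> 'v \<Rightarrow> real" where
  "of_l2 u = (\<lambda>x. coord u x / sqrt (m x))"

lemma ell2_iff: "f \<in> ell2 m \<longleftrightarrow> sq_summable (\<lambda>x. f x * sqrt (m x))"
  by (simp add: ell2_def sq_summable_def power_mult_distrib m_nonneg)

lemma coord_to_l2: "f \<in> ell2 m \<Longrightarrow> coord (to_l2 f) x = f x * sqrt (m x)"
  by (simp add: to_l2_def coord_l2_of ell2_iff)

lemma of_l2_ell2: "of_l2 u \<in> ell2 m"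
  using sq_summable_coord[of u] m_neq_0 by (simp add: ell2_iff of_l2_def)

lemma to_l2_of_l2: "to_l2 (of_l2 u) = u"
  by (rule l2_eqI) (simp add: coord_to_l2 of_l2_ell2, simp add: of_l2_def m_neq_0)

lemma of_l2_to_l2: "f \<in> ell2 m \<Longrightarrow> of_l2 (to_l2 f) = f"
  by (rule ext) (simp add: of_l2_def coord_to_l2 m_neq_0)

lemma of_l2_add: "of_l2 (u + v) = (\<lambda>x. of_l2 u x + of_l2 v x)"
  by (simp add: of_l2_def add_divide_distrib)

lemma of_l2_scale: "of_l2 (a *\<^sub>R u) = (\<lambda>x. a * of_l2 u x)"
  by (simp add: of_l2_def)

lemma of_l2_diff: "of_l2 (u - v) = (\<lambda>x. of_l2 u x - of_l2 v x)"
  by (simp add: of_l2_def diff_divide_distrib)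

lemma of_l2_minus: "of_l2 (- u) = (\<lambda>x. - of_l2 u x)"
  by (simp add: of_l2_def)

lemma of_l2_zero: "of_l2 0 = (\<lambda>x. 0)"
  by (simp add: of_l2_def)

lemma ell2_add: "f \<in> ell2 m \<Longrightarrow> g \<in> ell2 m \<Longrightarrow> (\<lambda>x. f x + g x) \<in> ell2 m"
  using of_l2_ell2[of "to_l2 f + to_l2 g"] by (simp add: of_l2_add of_l2_to_l2)

lemma ell2_scale: "f \<in> ell2 m \<Longrightarrow> (\<lambda>x. a * f x) \<in> ell2 m"
  using of_l2_ell2[of "a *\<^sub>R to_l2 f"] by (simp add: of_l2_scale of_l2_to_l2)

lemma ell2_diff: "f \<in> ell2 m \<Longrightarrow> g \<in> ell2 m \<Longrightarrow> (\<lambda>x. f x - g x) \<in> ell2 m"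
  using of_l2_ell2[of "to_l2 f - to_l2 g"] by (simp add: of_l2_diff of_l2_to_l2)

lemma ell2_minus: "f \<in> ell2 m \<Longrightarrow> (\<lambda>x. - f x) \<in> ell2 m"
  using of_l2_ell2[of "- to_l2 f"] by (simp add: of_l2_minus of_l2_to_l2)

lemma to_l2_add: "f \<in> ell2 m \<Longrightarrow> g \<in> ell2 m \<Longrightarrow> to_l2 (\<lambda>x. f x + g x) = to_l2 f + to_l2 g"
  by (rule l2_eqI) (simp add: coord_to_l2 ell2_add algebra_simps)

lemma to_l2_scale: "f \<in> ell2 m \<Longrightarrow> to_l2 (\<lambda>x. a * f x) = a *\<^sub>R to_l2 f"
  by (rule l2_eqI) (simp add: coord_to_l2 ell2_scale)

lemma to_l2_diff: "f \<in> ell2 m \<Longrightarrow> g \<in> ell2 m \<Longrightarrow> to_l2 (\<lambda>x. f x - g x) = to_l2 f - to_l2 g"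
  by (rule l2_eqI) (simp add: coord_to_l2 ell2_diff algebra_simps)

lemma to_l2_minus: "f \<in> ell2 m \<Longrightarrow> to_l2 (\<lambda>x. - f x) = - to_l2 f"
  by (rule l2_eqI) (simp add: coord_to_l2 ell2_minus)

lemma inner_to_l2: "f \<in> ell2 m \<Longrightarrow> g \<in> ell2 m \<Longrightarrow> inner (to_l2 f) (to_l2 g) = ell2_inner m f g"
proof -
  assume fg: "f \<in> ell2 m" "g \<in> ell2 m"
  have "f x * sqrt (m x) * (g x * sqrt (m x)) = f x * g x * m x" for x
  proof -
    have "f x * sqrt (m x) * (g x * sqrt (m x)) = f x * g x * (sqrt (m x) * sqrt (m x))"
      by (simp only: ac_simps)
    thus ?thesis using m_nonneg[of x] by simp
  qed
  thus ?thesis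
    by (simp only: inner_l2_def coord_to_l2[OF fg(1)] coord_to_l2[OF fg(2)] ell2_inner_def)
qed

lemma norm_to_l2: "f \<in> ell2 m \<Longrightarrow> norm (to_l2 f) = ell2_norm m f"
  by (simp add: norm_eq_sqrt_inner inner_to_l2 ell2_norm_def)

text \<open>The form is the inner product of gradients: one component for the edges, one for the
potential \<open>c\<close>. The factor \<open>1/2\<close> compensates that each edge occurs as two ordered pairs.\<close>

definition grad :: "('v \<Rightarrow> real) \<Rightarrow> ('v \<times> 'v) l2 \<times> 'v l2" where
  "grad f = (l2_of (\<lambda>(x, y). sqrt (b x y / 2) * (f x - f y)), l2_of (\<lambda>x. sqrt (c x) * f x))"

lemma finite_energy_iff:
  "finite_energy b c f \<longleftrightarrow> sq_summable (\<lambda>(x, y). sqrt (b x y / 2) * (f x - f y))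
     \<and> sq_summable (\<lambda>x. sqrt (c x) * f x)"
proof -
  have "(\<lambda>z. (case z of (x, y) \<Rightarrow> sqrt (b x y / 2) * (f x - f y))\<^sup>2)
      = (\<lambda>z. 1 / 2 * (case z of (x, y) \<Rightarrow> b x y * (f x - f y)\<^sup>2))"
    by (auto simp: power_mult_distrib b_nonneg)
  moreover have "(\<lambda>z. 1 / 2 * (case z of (x, y) \<Rightarrow> b x y * (f x - f y)\<^sup>2)) summable_on UNIV
      \<longleftrightarrow> (\<lambda>(x, y). b x y * (f x - f y)\<^sup>2) summable_on UNIV"
    by (rule summable_on_cmult_right') simp
  ultimately show ?thesis
    by (simp add: finite_energy_def sq_summable_def power_mult_distrib c_nonneg)
qed

lemma coord_grad:
  assumes "finite_energy b c f"
  shows "coord (fst (grad f)) (x, y) = sqrt (b x y / 2) * (f x - f y)"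
    and "coord (snd (grad f)) x = sqrt (c x) * f x"
  using assms by (simp_all add: grad_def coord_l2_of finite_energy_iff)

lemma energy_add:
  assumes "finite_energy b c f" "finite_energy b c g"
  shows "finite_energy b c (\<lambda>x. f x + g x)"
proof -
  have "(\<lambda>(x, y). sqrt (b x y / 2) * (f x + g x - (f y + g y)))
    = (\<lambda>z. (case z of (x, y) \<Rightarrow> sqrt (b x y / 2) * (f x - f y)) + (case z of (x, y) \<Rightarrow> sqrt (b x y / 2) * (g x - g y)))"
    by (auto simp: algebra_simps)
  thus ?thesis using assms by (simp add: finite_energy_iff sq_summable_add distrib_left)
qed

lemma energy_scale:
  assumes "finite_energy b c f"
  shows "finite_energy b c (\<lambda>x. a * f x)"
proof -
  have "(\<lambda>(x, y). sqrt (b x y / 2) * (a * f x - a * f y))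
    = (\<lambda>z. a * (case z of (x, y) \<Rightarrow> sqrt (b x y / 2) * (f x - f y)))"
    by (auto simp: algebra_simps)
  moreover have "(\<lambda>x. sqrt (c x) * (a * f x)) = (\<lambda>x. a * (sqrt (c x) * f x))"
    by (auto simp: algebra_simps)
  ultimately show ?thesis using assms by (simp add: finite_energy_iff sq_summable_scale)
qed

lemma energy_diff:
  assumes "finite_energy b c f" "finite_energy b c g"
  shows "finite_energy b c (\<lambda>x. f x - g x)"
  using energy_add[OF assms(1) energy_scale[OF assms(2), of "- 1"]] by simp

lemma grad_add:
  assumes "finite_energy b c f" "finite_energy b c g"
  shows "grad (\<lambda>x. f x + g x) = grad f + grad g"
  by (rule pair_l2_eqI) (simp_all add: coord_grad assms energy_add algebra_simps)

lemma grad_scale: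
  assumes "finite_energy b c f"
  shows "grad (\<lambda>x. a * f x) = a *\<^sub>R grad f"
  by (rule pair_l2_eqI) (simp_all add: coord_grad assms energy_scale algebra_simps)

lemma grad_diff:
  assumes "finite_energy b c f" "finite_energy b c g"
  shows "grad (\<lambda>x. f x - g x) = grad f - grad g"
  using grad_add[OF assms(1) energy_scale[OF assms(2), of "- 1"]] grad_scale[OF assms(2), of "- 1"] by simp

lemma inner_grad:
  assumes f: "finite_energy b c f" and g: "finite_energy b c g"
  shows "inner (grad f) (grad g) = form_Q b c f g"
proof -
  have "coord (fst (grad f)) z * coord (fst (grad g)) z
      = 1 / 2 * (case z of (x, y) \<Rightarrow> b x y * (f x - f y) * (g x - g y))" for z
  proof (cases z)
    case (Pair x y)
    have "sqrt (b x y / 2) * (f x - f y) * (sqrt (b x y / 2) * (g x - g y))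
        = (sqrt (b x y / 2) * sqrt (b x y / 2)) * ((f x - f y) * (g x - g y))"
      by (simp only: ac_simps)
    also have "sqrt (b x y / 2) * sqrt (b x y / 2) = b x y / 2" using b_nonneg[of x y] by simp
    finally show ?thesis by (simp add: Pair coord_grad f g)
  qed
  moreover have "coord (snd (grad f)) x * coord (snd (grad g)) x = c x * f x * g x" for x
    using c_nonneg[of x] by (simp add: coord_grad f g algebra_simps)
  ultimately show ?thesis
    by (simp only: inner_prod_def inner_l2_def form_Q_def infsum_cmult_right')
qed

lemma finsupp_ell2: "f \<in> finitely_supported \<Longrightarrow> f \<in> ell2 m"
  using m_neq_0 by (simp add: ell2_iff sq_summable_finite_support finitely_supported_def)

lemma finsupp_energy:
  assumes f: "f \<in> finitely_supported"
  shows "finite_energy b c f"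
proof -
  define F where "F = {x. f x \<noteq> 0}"
  have F: "finite F" using f by (simp add: F_def finitely_supported_def)
  have "{z. (case z of (x, y) \<Rightarrow> sqrt (b x y / 2) * (f x - f y)) \<noteq> 0}
      \<subseteq> (SIGMA x:F. {y. 0 < b x y}) \<union> prod.swap ` (SIGMA x:F. {y. 0 < b x y})"
  proof
    fix z assume z: "z \<in> {z. (case z of (x, y) \<Rightarrow> sqrt (b x y / 2) * (f x - f y)) \<noteq> 0}"
    obtain x y where xy: "z = (x, y)" by (cases z)
    have "b x y \<noteq> 0" "f x \<noteq> f y" using z xy by auto
    hence b: "0 < b x y" "0 < b y x" and "x \<in> F \<or> y \<in> F"
      using b_nonneg[of x y] b_sym[of x y] by (auto simp: F_def)
    thus "z \<in> (SIGMA x:F. {y. 0 < b x y}) \<union> prod.swap ` (SIGMA x:F. {y. 0 < b x y})"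
      unfolding xy by (auto intro!: image_eqI[of _ prod.swap "(y, x)"])
  qed
  moreover have "finite (SIGMA x:F. {y. 0 < b x y})" using F finite_neighbors by blast
  ultimately have "finite {z. (case z of (x, y) \<Rightarrow> sqrt (b x y / 2) * (f x - f y)) \<noteq> 0}"
    by (meson finite_UnI finite_imageI finite_subset)
  moreover have "finite {x. sqrt (c x) * f x \<noteq> 0}"
    by (rule finite_subset[OF _ F]) (auto simp: F_def)
  ultimately show ?thesis unfolding finite_energy_iff by (intro conjI sq_summable_finite_support)
qed

lemma finsupp_add: "f \<in> finitely_supported \<Longrightarrow> g \<in> finitely_supported \<Longrightarrow> (\<lambda>x. f x + g x :: real) \<in> finitely_supported"
  unfolding finitely_supported_def mem_Collect_eq
  by (rule finite_subset[of _ "{x. f x \<noteq> 0} \<union> {x. g x \<noteq> 0}"]) auto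

lemma finsupp_scale: "f \<in> finitely_supported \<Longrightarrow> (\<lambda>x. a * f x :: real) \<in> finitely_supported"
  unfolding finitely_supported_def mem_Collect_eq
  by (rule finite_subset[of _ "{x. f x \<noteq> 0}"]) auto

lemma finsupp_diff: "f \<in> finitely_supported \<Longrightarrow> g \<in> finitely_supported \<Longrightarrow> (\<lambda>x. f x - g x :: real) \<in> finitely_supported"
  using finsupp_add[of f "\<lambda>x. - 1 * g x"] finsupp_scale[of g "- 1"] by simp

text \<open>The graph of the gradient on finitely supported functions. Its closure in the product
space is the gradient on the form domain, as the graph norm is the form norm.\<close>

definition grad_graph :: "('v l2 \<times> (('v \<times> 'v) l2 \<times> 'v l2)) set" where
  "grad_graph = {(to_l2 f, grad f) | f. f \<in> finitely_supported}"

abbreviation closed_grad where "closed_grad \<equiv> closure grad_graph"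

lemma grad_graphI: "f \<in> finitely_supported \<Longrightarrow> (to_l2 f, grad f) \<in> grad_graph"
  by (auto simp: grad_graph_def)

lemma subspace_grad_graph: "subspace grad_graph"
proof (rule subspaceI)
  have z: "(\<lambda>x. 0) \<in> finitely_supported" by (simp add: finitely_supported_def)
  show "0 \<in> grad_graph"
    using grad_graphI[OF z] to_l2_scale[OF finsupp_ell2[OF z], of 0] grad_scale[OF finsupp_energy[OF z], of 0]
    by (simp add: zero_prod_def)
next
  fix u v assume "u \<in> grad_graph" "v \<in> grad_graph"
  then obtain f g where fg: "f \<in> finitely_supported" "g \<in> finitely_supported"
    "u = (to_l2 f, grad f)" "v = (to_l2 g, grad g)" by (auto simp: grad_graph_def)
  thus "u + v \<in> grad_graph" using grad_graphI[OF finsupp_add[OF fg(1,2)]]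
    by (simp add: to_l2_add grad_add finsupp_ell2 finsupp_energy)
next
  fix a u assume "u \<in> grad_graph"
  then obtain f where f: "f \<in> finitely_supported" "u = (to_l2 f, grad f)"
    by (auto simp: grad_graph_def)
  thus "a *\<^sub>R u \<in> grad_graph" using grad_graphI[OF finsupp_scale[OF f(1)], of a]
    by (simp add: to_l2_scale grad_scale finsupp_ell2 finsupp_energy)
qed

lemmas subspace_closed_grad = subspace_closure[OF subspace_grad_graph]

lemma tendsto_of_l2: "(X \<longlongrightarrow> u) F \<Longrightarrow> ((\<lambda>n. of_l2 (X n) x) \<longlongrightarrow> of_l2 u x) F"
  unfolding of_l2_def by (intro tendsto_intros) (auto simp: m_neq_0)

lemma closed_grad_sequence:
  assumes "(u, k) \<in> closed_grad"
  obtains p where "\<And>n. p n \<in> finitely_supported" "(\<lambda>n. to_l2 (p n)) \<longlonglongrightarrow> u" "(\<lambda>n. grad (p n)) \<longlonglongrightarrow> k"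
proof -
  obtain X where X: "\<And>n. X n \<in> grad_graph" "X \<longlonglongrightarrow> (u, k)"
    using assms unfolding closure_sequential by blast
  have "\<forall>n. \<exists>f. f \<in> finitely_supported \<and> X n = (to_l2 f, grad f)"
    using X(1) by (auto simp: grad_graph_def)
  then obtain p where p: "\<And>n. p n \<in> finitely_supported" "\<And>n. X n = (to_l2 (p n), grad (p n))"
    by metis
  show ?thesis using that[OF p(1)] tendsto_fst[OF X(2)] tendsto_snd[OF X(2)] by (simp add: p(2))
qed

text \<open>The form is closable: convergence in norm implies pointwise convergence, and the
coordinates of the gradient of \<open>f\<close> depend on finitely many values of \<open>f\<close>.\<close>

lemma closed_grad_grad:
  assumes "(u, k) \<in> closed_grad"
  shows "finite_energy b c (of_l2 u)" and "k = grad (of_l2 u)"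
proof -
  obtain p where p: "\<And>n. p n \<in> finitely_supported"
    "(\<lambda>n. to_l2 (p n)) \<longlonglongrightarrow> u" "(\<lambda>n. grad (p n)) \<longlonglongrightarrow> k" by (rule closed_grad_sequence[OF assms]) blast
  have px: "(\<lambda>n. p n x) \<longlonglongrightarrow> of_l2 u x" for x
    using tendsto_of_l2[OF p(2), of x] by (simp add: of_l2_to_l2 finsupp_ell2 p(1))
  have k1: "coord (fst k) (x, y) = sqrt (b x y / 2) * (of_l2 u x - of_l2 u y)" for x y
  proof -
    have "(\<lambda>n. coord (fst (grad (p n))) (x, y)) \<longlonglongrightarrow> coord (fst k) (x, y)"
      by (intro tendsto_intros p)
    moreover have "(\<lambda>n. sqrt (b x y / 2) * (p n x - p n y)) \<longlonglongrightarrow> sqrt (b x y / 2) * (of_l2 u x - of_l2 u y)"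
      by (intro tendsto_intros px)
    ultimately show ?thesis by (simp add: coord_grad finsupp_energy p(1) LIMSEQ_unique)
  qed
  have k2: "coord (snd k) x = sqrt (c x) * of_l2 u x" for x
  proof -
    have "(\<lambda>n. coord (snd (grad (p n))) x) \<longlonglongrightarrow> coord (snd k) x"
      by (intro tendsto_intros p)
    moreover have "(\<lambda>n. sqrt (c x) * p n x) \<longlonglongrightarrow> sqrt (c x) * of_l2 u x"
      by (intro tendsto_intros px)
    ultimately show ?thesis by (simp add: coord_grad finsupp_energy p(1) LIMSEQ_unique)
  qed
  have "coord (fst k) = (\<lambda>(x, y). sqrt (b x y / 2) * (of_l2 u x - of_l2 u y))"
    "coord (snd k) = (\<lambda>x. sqrt (c x) * of_l2 u x)"
    using k1 k2 by auto
  thus fe: "finite_energy b c (of_l2 u)"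
    unfolding finite_energy_iff using sq_summable_coord by metis
  show "k = grad (of_l2 u)"
    by (rule pair_l2_eqI) (simp_all add: coord_grad fe k1 k2)
qed

lemma form_norm:
  assumes "f \<in> ell2 m" "finite_energy b c f"
  shows "ell2_inner m f f + form_Q b c f f = (norm (to_l2 f, grad f))\<^sup>2"
  using assms
    by (simp add: norm_Pair inner_to_l2[symmetric] inner_grad[symmetric] power2_norm_eq_inner)

lemma form_domain_iff:
  "f \<in> form_domain b c m \<longleftrightarrow> f \<in> ell2 m \<and> finite_energy b c f \<and> (to_l2 f, grad f) \<in> closed_grad"
proof -
  have *: "((\<lambda>n. ell2_inner m (\<lambda>x. f x - p n x) (\<lambda>x. f x - p n x)
       + form_Q b c (\<lambda>x. f x - p n x) (\<lambda>x. f x - p n x)) \<longlonglongrightarrow> 0)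
     \<longleftrightarrow> (\<lambda>n. (to_l2 (p n), grad (p n))) \<longlonglongrightarrow> (to_l2 f, grad f)"
    if f: "f \<in> ell2 m" "finite_energy b c f" and p: "\<And>n. p n \<in> finitely_supported" for p
  proof -
    have "ell2_inner m (\<lambda>x. f x - p n x) (\<lambda>x. f x - p n x)
       + form_Q b c (\<lambda>x. f x - p n x) (\<lambda>x. f x - p n x)
       = (norm ((to_l2 (p n), grad (p n)) - (to_l2 f, grad f)))\<^sup>2" for n
      using form_norm[OF ell2_diff[OF f(1) finsupp_ell2[OF p]] energy_diff[OF f(2) finsupp_energy[OF p]]]
      by (simp add: to_l2_diff grad_diff f p finsupp_ell2 finsupp_energy
          norm_minus_commute[of "(to_l2 (p n), grad (p n))"] del: norm_Pair)
        (simp add: norm_Pair norm_minus_commute)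
    moreover have "(\<lambda>n. (norm (Y n :: 'v l2 \<times> ('v \<times> 'v) l2 \<times> 'v l2))\<^sup>2) \<longlonglongrightarrow> 0 \<longleftrightarrow> Y \<longlonglongrightarrow> 0" for Y
    proof
      assume "(\<lambda>n. (norm (Y n))\<^sup>2) \<longlonglongrightarrow> 0"
      from tendsto_real_sqrt[OF this] show "Y \<longlonglongrightarrow> 0" by (simp add: tendsto_norm_zero_iff)
    next
      assume "Y \<longlonglongrightarrow> 0"
      from tendsto_power[OF tendsto_norm_zero[OF this], of 2] show "(\<lambda>n. (norm (Y n))\<^sup>2) \<longlonglongrightarrow> 0"
        by simp
    qed
    ultimately show ?thesis by (simp only: LIM_zero_iff)
  qed
  show ?thesis
  proof
    assume "f \<in> form_domain b c m"
    then obtain p where f: "f \<in> ell2 m" "finite_energy b c f" and p: "\<And>n. p n \<in> finitely_supported"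
      "(\<lambda>n. ell2_inner m (\<lambda>x. f x - p n x) (\<lambda>x. f x - p n x)
       + form_Q b c (\<lambda>x. f x - p n x) (\<lambda>x. f x - p n x)) \<longlonglongrightarrow> 0"
      unfolding form_domain_def by blast
    have "(\<lambda>n. (to_l2 (p n), grad (p n))) \<longlonglongrightarrow> (to_l2 f, grad f)"
      using *[OF f, of p, OF p(1)] p(2) by blast
    hence "(to_l2 f, grad f) \<in> closed_grad" unfolding closure_sequential using grad_graphI[OF p(1)]
      by (intro exI[of _ "\<lambda>n. (to_l2 (p n), grad (p n))"]) simp
    thus "f \<in> ell2 m \<and> finite_energy b c f \<and> (to_l2 f, grad f) \<in> closed_grad" using f by blast
  next
    assume f: "f \<in> ell2 m \<and> finite_energy b c f \<and> (to_l2 f, grad f) \<in> closed_grad"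
    then obtain p where p: "\<And>n. p n \<in> finitely_supported"
      "(\<lambda>n. to_l2 (p n)) \<longlonglongrightarrow> to_l2 f" "(\<lambda>n. grad (p n)) \<longlonglongrightarrow> grad f"
      using closed_grad_sequence by blast
    have "(\<lambda>n. (to_l2 (p n), grad (p n))) \<longlonglongrightarrow> (to_l2 f, grad f)" by (intro tendsto_Pair p)
    thus "f \<in> form_domain b c m" unfolding form_domain_def using *[of p] f p(1) by blast
  qed
qed

lemma finsupp_form_domain: "f \<in> finitely_supported \<Longrightarrow> f \<in> form_domain b c m"
  using grad_graphI closure_subset by (auto simp: form_domain_iff finsupp_ell2 finsupp_energy)

definition laplacian :: "('v \<Rightarrow> real) \<Rightarrow> 'v \<Rightarrow> real" where
  "laplacian f x = ((\<Sum>y | 0 < b x y. b x y * (f x - f y)) + c x * f x) / m x"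

lemma laplacian_fin:
  assumes "f \<in> finitely_supported"
  shows "laplacian f \<in> finitely_supported"
proof -
  define F where "F = {x. f x \<noteq> 0}"
  have "finite F" using assms by (simp add: F_def finitely_supported_def)
  hence fin: "finite (F \<union> (\<Union>x\<in>F. {y. 0 < b x y}))" using finite_neighbors by blast
  have "laplacian f x = 0" if "x \<notin> F \<union> (\<Union>x\<in>F. {y. 0 < b x y})" for x
  proof -
    have "f y = 0" if "0 < b x y" for y
      using that \<open>x \<notin> _\<close> b_sym[of x y] by (auto simp: F_def)
    moreover have "f x = 0" using that by (simp add: F_def)
    ultimately show ?thesis by (simp add: laplacian_def)
  qed
  hence "{x. laplacian f x \<noteq> 0} \<subseteq> F \<union> (\<Union>x\<in>F. {y. 0 < b x y})" by blast
  thus ?thesis unfolding finitely_supported_def using fin finite_subset by blast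
qed

text \<open>Both sums reduce to a finite set \<open>F'\<close> that contains the supports and their neighbours;
there the double sum is symmetrised by exchanging \<open>x\<close> and \<open>y\<close>.\<close>

lemma green:
  assumes f: "f \<in> finitely_supported" and g: "g \<in> finitely_supported"
  shows "form_Q b c f g = ell2_inner m (laplacian f) g"
proof -
  define F where "F = {x. f x \<noteq> 0} \<union> {x. g x \<noteq> 0}"
  define F' where "F' = F \<union> (\<Union>x\<in>F. {y. 0 < b x y})"
  have F: "finite F" using f g by (simp add: F_def finitely_supported_def)
  hence F': "finite F'" using finite_neighbors by (auto simp: F'_def)
  have out: "f x = 0" "g x = 0" if "x \<notin> F'" for x using that by (auto simp: F'_def F_def)
  have nb: "b x y = 0" if "x \<in> F" "y \<notin> F'" for x y
    using that b_nonneg[of x y] by (force simp: F'_def)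
  have "(\<Sum>\<^sub>\<infinity>(x, y). b x y * (f x - f y) * (g x - g y)) = (\<Sum>\<^sub>\<infinity>(x, y)\<in>F' \<times> F'. b x y * (f x - f y) * (g x - g y))"
  proof (rule infsum_cong_neutral)
    fix z assume "z \<in> UNIV - F' \<times> F'"
    then obtain x y where z: "z = (x, y)" "x \<notin> F' \<or> y \<notin> F'" by (cases z) auto
    have "b x y * (f x - f y) * (g x - g y) = 0"
    proof (cases "x \<in> F \<or> y \<in> F")
      case True
      hence "b x y = 0" using z(2) nb[of x y] nb[of y x] b_sym[of x y] by (auto simp: F'_def)
      thus ?thesis by simp
    qed (simp add: F_def)
    thus "(case z of (x, y) \<Rightarrow> b x y * (f x - f y) * (g x - g y)) = 0" by (simp add: z)
  qed auto
  also have "\<dots> = (\<Sum>x\<in>F'. \<Sum>y\<in>F'. b x y * (f x - f y) * (g x - g y))"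
    using F' by (simp add: sum.cartesian_product)
  also have "\<dots> = (\<Sum>x\<in>F'. \<Sum>y\<in>F'. b x y * (f x - f y) * g x) - (\<Sum>x\<in>F'. \<Sum>y\<in>F'. b x y * (f x - f y) * g y)"
    by (simp add: sum_subtractf[symmetric] right_diff_distrib)
  also have "(\<Sum>x\<in>F'. \<Sum>y\<in>F'. b x y * (f x - f y) * g y) = (\<Sum>y\<in>F'. \<Sum>x\<in>F'. b x y * (f x - f y) * g y)"
    by (rule sum.swap)
  also have "\<dots> = - (\<Sum>x\<in>F'. \<Sum>y\<in>F'. b x y * (f x - f y) * g x)"
    unfolding sum_negf[symmetric] by (intro sum.cong refl) (simp add: b_sym algebra_simps)
  finally have 1: "1 / 2 * (\<Sum>\<^sub>\<infinity>(x, y). b x y * (f x - f y) * (g x - g y))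
      = (\<Sum>x\<in>F'. \<Sum>y\<in>F'. b x y * (f x - f y) * g x)" by simp
  have 2: "(\<Sum>\<^sub>\<infinity>x. c x * f x * g x) = (\<Sum>x\<in>F'. c x * f x * g x)"
  proof -
    have "(\<Sum>\<^sub>\<infinity>x. c x * f x * g x) = (\<Sum>\<^sub>\<infinity>x\<in>F'. c x * f x * g x)"
      by (rule infsum_cong_neutral) (auto simp: out)
    thus ?thesis using F' by simp
  qed
  have 3: "ell2_inner m (laplacian f) g = (\<Sum>x\<in>F'. laplacian f x * g x * m x)"
  proof -
    have "ell2_inner m (laplacian f) g = (\<Sum>\<^sub>\<infinity>x\<in>F'. laplacian f x * g x * m x)"
      unfolding ell2_inner_def by (rule infsum_cong_neutral) (auto simp: out)
    thus ?thesis using F' by simp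
  qed
  have "(\<Sum>y\<in>F'. b x y * (f x - f y) * g x) + c x * f x * g x = laplacian f x * g x * m x" for x
  proof (cases "g x = 0")
    case False
    hence x: "x \<in> F" by (simp add: F_def)
    have "(\<Sum>y\<in>F'. b x y * (f x - f y)) = (\<Sum>y | 0 < b x y. b x y * (f x - f y))"
    proof (rule sum.mono_neutral_right[OF F'])
      show "{y. 0 < b x y} \<subseteq> F'" using x by (auto simp: F'_def)
      show "\<forall>y\<in>F' - {y. 0 < b x y}. b x y * (f x - f y) = 0"
        using b_nonneg[of x] by (auto simp: order.order_iff_strict)
    qed
    hence "laplacian f x * m x = (\<Sum>y\<in>F'. b x y * (f x - f y)) + c x * f x"
      by (simp add: laplacian_def m_neq_0)
    hence "laplacian f x * m x * g x = (\<Sum>y\<in>F'. b x y * (f x - f y)) * g x + c x * f x * g x"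
      by (simp only: distrib_right)
    moreover have "laplacian f x * g x * m x = laplacian f x * m x * g x" by simp
    ultimately show ?thesis by (simp only: sum_distrib_right)
  qed simp
  thus ?thesis unfolding form_Q_def 1 2 3 sum.distrib[symmetric] by (intro sum.cong) auto
qed

text \<open>The graph of \<open>L\<close>, transported to the unweighted space. Testing with finitely supported
functions suffices, because both sides are continuous in the graph norm.\<close>

definition L_graph :: "('v l2 \<times> 'v l2) set" where
  "L_graph = {(u, w). \<exists>k. (u, k) \<in> closed_grad \<and> (\<forall>(v, l)\<in>grad_graph. inner k l = inner w v)}"

lemma L_graphI: "(u, k) \<in> closed_grad \<Longrightarrow> (\<And>v l. (v, l) \<in> grad_graph \<Longrightarrow> inner k l = inner w v) \<Longrightarrow> (u, w) \<in> L_graph"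
  unfolding L_graph_def by blast

lemma L_graphE:
  assumes "(u, w) \<in> L_graph"
  obtains k where "(u, k) \<in> closed_grad" "\<And>v l. (v, l) \<in> grad_graph \<Longrightarrow> inner k l = inner w v"
  using assms unfolding L_graph_def by blast

lemma L_graph_extend:
  assumes "\<forall>(v, l)\<in>grad_graph. inner k l = inner w v" "(v, l) \<in> closed_grad"
  shows "inner k l = inner w v"
proof -
  have "closed {z. inner k (snd z) = inner w (fst z)}"
    by (intro closed_Collect_eq continuous_intros)
  moreover have "grad_graph \<subseteq> {z. inner k (snd z) = inner w (fst z)}" using assms(1) by auto
  ultimately have "closed_grad \<subseteq> {z. inner k (snd z) = inner w (fst z)}"
    by (rule closure_minimal[rotated])
  thus ?thesis using assms(2) by auto
qed

lemma finsupp_L_graph: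
  assumes "f \<in> finitely_supported"
  shows "(to_l2 f, to_l2 (laplacian f)) \<in> L_graph"
proof -
  have "inner (grad f) l = inner (to_l2 (laplacian f)) v" if "(v, l) \<in> grad_graph" for v l
    using that assms laplacian_fin[OF assms]
    by (auto simp: grad_graph_def inner_grad inner_to_l2 finsupp_energy finsupp_ell2 green)
  thus ?thesis using grad_graphI[OF assms] closure_subset[of grad_graph] unfolding L_graph_def by blast
qed

text \<open>For \<open>f + l L f = g\<close> project \<open>(g, 0)\<close> onto the closed graph of \<open>l\<^sup>1\<^sup>/\<^sup>2\<close> times the
gradient: orthogonality of the error says that \<open>\<langle>g - f, v\<rangle> = l Q(f, v)\<close> for all \<open>v\<close>.\<close>

lemma maximal_monotone_L_graph: "maximal_monotone L_graph"
proof
  show "subspace L_graph"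
  proof (rule subspaceI)
    have "(0, 0) \<in> closed_grad"
      using subspace_0[OF subspace_closed_grad] by (simp only: zero_prod_def)
    hence "(0, 0) \<in> L_graph" by (rule L_graphI) simp
    thus "0 \<in> L_graph" by (simp add: zero_prod_def)
  next
    fix p q assume pq: "p \<in> L_graph" "q \<in> L_graph"
    obtain u w u' w' where p: "p = (u, w)" "q = (u', w')" by (cases p, cases q)
    from pq obtain k k' where k: "(u, k) \<in> closed_grad" "\<And>v l. (v, l) \<in> grad_graph \<Longrightarrow> inner k l = inner w v"
      "(u', k') \<in> closed_grad" "\<And>v l. (v, l) \<in> grad_graph \<Longrightarrow> inner k' l = inner w' v"
      unfolding p by (elim L_graphE) blast
    have "(u + u', k + k') \<in> closed_grad"
      using subspace_add[OF subspace_closed_grad k(1,3)] by simp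
    hence "(u + u', w + w') \<in> L_graph" by (rule L_graphI) (simp add: inner_add_left k)
    thus "p + q \<in> L_graph" by (simp add: p)
  next
    fix a p assume pG: "p \<in> L_graph"
    obtain u w where p: "p = (u, w)" by (cases p)
    from pG obtain k where k: "(u, k) \<in> closed_grad" "\<And>v l. (v, l) \<in> grad_graph \<Longrightarrow> inner k l = inner w v"
      unfolding p by (elim L_graphE) blast
    have "(a *\<^sub>R u, a *\<^sub>R k) \<in> closed_grad"
      using subspace_scale[OF subspace_closed_grad k(1)] by simp
    hence "(a *\<^sub>R u, a *\<^sub>R w) \<in> L_graph" by (rule L_graphI) (simp add: k)
    thus "a *\<^sub>R p \<in> L_graph" by (simp add: p)
  qed
next
  fix u w assume "(u, w) \<in> L_graph"
  then obtain k where k: "(u, k) \<in> closed_grad" "\<forall>(v, l)\<in>grad_graph. inner k l = inner w v"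
    by (auto simp: L_graph_def)
  have "inner u w = inner k k" using L_graph_extend[OF k(2,1)] by (simp add: inner_commute)
  thus "0 \<le> inner u w" by simp
next
  fix l :: real and g :: "'v l2" assume l: "0 < l"
  define s where "s = sqrt l"
  have s: "s > 0" "s * s = l" using l by (auto simp: s_def)
  \<comment> \<open>Rescaling the gradient turns the weighted product with weights \<open>1\<close> and \<open>l\<close> into the plain one.\<close>
  define h where "h z = (fst z, inverse s *\<^sub>R snd z)" for z :: "'v l2 \<times> ('v \<times> 'v) l2 \<times> 'v l2"
  have lin: "linear h" by (auto intro!: linearI simp: h_def algebra_simps)
  have "closed (h -` closed_grad)"
    by (rule closed_vimage) (auto simp: h_def intro!: continuous_intros)
  moreover have "subspace (h -` closed_grad)"
    using linear_subspace_vimage[OF lin subspace_closed_grad] .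
  ultimately obtain p where p: "p \<in> h -` closed_grad" "\<And>v. v \<in> h -` closed_grad \<Longrightarrow> inner ((g, 0) - p) v = 0"
    using orthogonal_projection_exists by meson
  obtain f K where fK: "p = (f, K)" by (cases p)
  have fW: "(f, inverse s *\<^sub>R K) \<in> closed_grad" using p(1) by (simp add: fK h_def)
  have "inner (inverse s *\<^sub>R K) q = inner ((g - f) /\<^sub>R l) v" if "(v, q) \<in> grad_graph" for v q
  proof -
    have "(v, s *\<^sub>R q) \<in> h -` closed_grad"
      using that closure_subset[of grad_graph] s by (auto simp: h_def)
    from p(2)[OF this] have "inner (g - f) v = s * inner K q" by (simp add: fK inner_diff_left)
    moreover have "inverse l * s = inverse s" using s by (simp add: field_simps flip: s(2))
    ultimately show ?thesis by (simp add: mult.assoc[symmetric])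
  qed
  hence "(f, (g - f) /\<^sub>R l) \<in> L_graph" unfolding L_graph_def using fW by blast
  thus "\<exists>f w. (f, w) \<in> L_graph \<and> f + l *\<^sub>R w = g"
    using l by (intro exI[of _ f] exI[of _ "(g - f) /\<^sub>R l"]) simp
next
  let ?D = "to_l2 ` finitely_supported"
  have "subspace ?D"
  proof (rule subspaceI)
    show "0 \<in> ?D"
      using subspace_0[OF subspace_grad_graph] by (force simp: grad_graph_def zero_prod_def)
    fix u v assume "u \<in> ?D" "v \<in> ?D"
    thus "u + v \<in> ?D" by (auto simp: to_l2_add[symmetric] finsupp_ell2 intro!: imageI finsupp_add)
  next
    fix a u assume "u \<in> ?D"
    thus "a *\<^sub>R u \<in> ?D"
      by (auto simp: to_l2_scale[symmetric] finsupp_ell2 intro!: imageI finsupp_scale)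
  qed
  moreover have "unit_vec x \<in> ?D" for x
  proof -
    let ?f = "\<lambda>y. if y = x then 1 / sqrt (m x) else 0"
    have f: "?f \<in> finitely_supported" by (simp add: finitely_supported_def)
    hence "unit_vec x = to_l2 ?f"
      by (intro l2_eqI) (simp add: coord_unit_vec coord_to_l2 finsupp_ell2 m_neq_0)
    thus ?thesis using f by blast
  qed
  ultimately have "closure ?D = UNIV" by (rule dense_subspace_l2)
  moreover have "?D \<subseteq> Domain L_graph" using finsupp_L_graph by auto
  ultimately show "closure (Domain L_graph) = UNIV" using closure_mono by blast
qed

sublocale maximal_monotone L_graph by (rule maximal_monotone_L_graph)

lemma L_graph_iff:
  assumes f: "f \<in> ell2 m" and h: "h \<in> ell2 m"
  shows "(to_l2 f, to_l2 h) \<in> L_graph \<longleftrightarrow>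
    f \<in> form_domain b c m \<and> (\<forall>g\<in>form_domain b c m. form_Q b c f g = ell2_inner m h g)"
proof
  assume "(to_l2 f, to_l2 h) \<in> L_graph"
  then obtain k where k: "(to_l2 f, k) \<in> closed_grad" "\<forall>(v, l)\<in>grad_graph. inner k l = inner (to_l2 h) v"
    by (auto simp: L_graph_def)
  have fe: "finite_energy b c f" "k = grad f"
    using closed_grad_grad[OF k(1)] f by (simp_all add: of_l2_to_l2)
  have "form_Q b c f g = ell2_inner m h g" if g: "g \<in> form_domain b c m" for g
  proof -
    have g': "g \<in> ell2 m" "finite_energy b c g" "(to_l2 g, grad g) \<in> closed_grad"
      using g by (auto simp: form_domain_iff)
    have "inner k (grad g) = inner (to_l2 h) (to_l2 g)" by (rule L_graph_extend[OF k(2) g'(3)])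
    thus ?thesis using g' fe h by (simp add: inner_grad inner_to_l2)
  qed
  thus "f \<in> form_domain b c m \<and> (\<forall>g\<in>form_domain b c m. form_Q b c f g = ell2_inner m h g)"
    using f fe k(1) by (simp add: form_domain_iff)
next
  assume *: "f \<in> form_domain b c m \<and> (\<forall>g\<in>form_domain b c m. form_Q b c f g = ell2_inner m h g)"
  hence fe: "finite_energy b c f" "(to_l2 f, grad f) \<in> closed_grad"
    by (auto simp: form_domain_iff)
  have "inner (grad f) l = inner (to_l2 h) v" if "(v, l) \<in> grad_graph" for v l
    using that * fe(1) h
      by (auto simp: grad_graph_def inner_grad inner_to_l2 finsupp_energy finsupp_ell2 finsupp_form_domain)
  thus "(to_l2 f, to_l2 h) \<in> L_graph" unfolding L_graph_def using fe(2) by blast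
qed

lemma L_iff:
  assumes f: "f \<in> ell2 m" and h: "h \<in> ell2 m"
  shows "f \<in> L_domain b c m \<and> h = (\<lambda>x. - L_op b c m f x) \<longleftrightarrow> (to_l2 f, - to_l2 h) \<in> L_graph"
proof -
  let ?P = "\<lambda>w. w \<in> ell2 m \<and> (\<forall>g\<in>form_domain b c m. form_Q b c f g = ell2_inner m w g)"
  have uniq: "w = w'" if "?P w" "?P w'" for w w'
  proof
    fix x :: 'v
    let ?d = "\<lambda>y. if y = x then 1 else 0 :: real"
    have d: "?d \<in> finitely_supported" by (simp add: finitely_supported_def)
    have "ell2_inner m v ?d = v x * m x" for v
    proof -
      have "ell2_inner m v ?d = (\<Sum>\<^sub>\<infinity>y\<in>{x}. v y * ?d y * m y)"
        unfolding ell2_inner_def by (rule infsum_cong_neutral) auto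
      thus ?thesis by simp
    qed
    thus "w x = w' x"
      using that finsupp_form_domain[OF d] m_neq_0[of x] by (metis mult_right_cancel)
  qed
  have L: "L_op b c m f = w" if "?P w" for w
    unfolding L_op_def using that uniq by (intro the_equality) blast+
  have mh: "(\<lambda>x. - h x) \<in> ell2 m" "- to_l2 h = to_l2 (\<lambda>x. - h x)"
    using h by (simp_all add: ell2_minus to_l2_minus)
  have "f \<in> L_domain b c m \<and> h = (\<lambda>x. - L_op b c m f x) \<longleftrightarrow> f \<in> form_domain b c m \<and> ?P (\<lambda>x. - h x)"
  proof
    assume *: "f \<in> L_domain b c m \<and> h = (\<lambda>x. - L_op b c m f x)"
    then obtain w where w: "f \<in> form_domain b c m" "?P w" by (auto simp: L_domain_def)
    have "(\<lambda>x. - h x) = w" using * L[OF w(2)] by auto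
    thus "f \<in> form_domain b c m \<and> ?P (\<lambda>x. - h x)" using w by simp
  next
    assume *: "f \<in> form_domain b c m \<and> ?P (\<lambda>x. - h x)"
    hence "L_op b c m f = (\<lambda>x. - h x)" by (intro L) blast
    thus "f \<in> L_domain b c m \<and> h = (\<lambda>x. - L_op b c m f x)" using * by (auto simp: L_domain_def)
  qed
  thus ?thesis using L_graph_iff[OF f mh(1)] mh by simp
qed

lemma generator_value_iff:
  assumes T: "\<And>t g. 0 \<le> t \<Longrightarrow> g \<in> ell2 m \<Longrightarrow> T t g \<in> ell2 m"
  shows "generator_value m T f h \<longleftrightarrow> f \<in> ell2 m \<and> h \<in> ell2 m
     \<and> (to_l2 f, to_l2 h) \<in> semigroup_generator (\<lambda>t u. to_l2 (T t (of_l2 u)))"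
proof (cases "f \<in> ell2 m \<and> h \<in> ell2 m")
  case True
  have "ell2_norm m (\<lambda>x. (T t f x - f x) / t - h x) = norm ((to_l2 (T t f) - to_l2 f) /\<^sub>R t - to_l2 h)"
    if t: "0 < t" for t
  proof -
    have Tf: "T t f \<in> ell2 m" using T True t by simp
    have "to_l2 (\<lambda>x. inverse t * (T t f x - f x) - h x) = (to_l2 (T t f) - to_l2 f) /\<^sub>R t - to_l2 h"
      using True Tf by (simp add: to_l2_diff to_l2_scale ell2_diff ell2_scale)
    moreover have "(\<lambda>x. inverse t * (T t f x - f x) - h x) \<in> ell2 m"
      using True Tf by (intro ell2_diff ell2_scale) auto
    ultimately have "ell2_norm m (\<lambda>x. inverse t * (T t f x - f x) - h x)
        = norm ((to_l2 (T t f) - to_l2 f) /\<^sub>R t - to_l2 h)"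
      using norm_to_l2 by metis
    thus ?thesis by (simp add: divide_inverse mult.commute)
  qed
  hence ev: "\<forall>\<^sub>F t in at_right 0. ell2_norm m (\<lambda>x. (T t f x - f x) / t - h x)
      = norm ((to_l2 (T t f) - to_l2 f) /\<^sub>R t - to_l2 h)"
    by (simp add: eventually_at_filter)
  show ?thesis using True
    by (simp add: generator_value_def semigroup_generator_def of_l2_to_l2 tendsto_cong[OF ev]
        tendsto_norm_zero_iff LIM_zero_iff)
qed (auto simp: generator_value_def)

text \<open>The heat semigroup is chosen by its defining property; this lemma guarantees that the choice
is not vacuous.\<close>

lemma heat_semigroup_exists:
  "\<exists>T. C0_semigroup m T \<and>
     (\<forall>f h. generator_value m T f h \<longleftrightarrow> f \<in> L_domain b c m \<and> h = (\<lambda>x. - L_op b c m f x))"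
proof -
  define T where "T t f = of_l2 (flow t (to_l2 f))" for t f
  have Te: "T t f \<in> ell2 m" for t f by (simp add: T_def of_l2_ell2)
  have "bounded_operator_ell2 m (T t)" if t: "0 \<le> t" for t
  proof -
    have "ell2_norm m (T t f) \<le> 1 * ell2_norm m f" if f: "f \<in> ell2 m" for f
      using norm_flow_le[OF t, of "to_l2 f"] norm_to_l2[OF Te, of t f] f
      by (simp add: norm_to_l2 T_def to_l2_of_l2)
    hence "\<exists>K. \<forall>f\<in>ell2 m. ell2_norm m (T t f) \<le> K * ell2_norm m f" by blast
    thus ?thesis unfolding bounded_operator_ell2_def using linear_flow[OF t] Te
      by (simp add: T_def to_l2_add to_l2_scale linear_add linear_scale of_l2_add of_l2_scale)
  qed
  moreover have "((\<lambda>t. ell2_norm m (\<lambda>x. T t f x - f x)) \<longlongrightarrow> 0) (at_right 0)" if f: "f \<in> ell2 m"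
    for f
  proof -
    have "ell2_norm m (\<lambda>x. T t f x - f x) = norm (flow t (to_l2 f) - to_l2 f)" for t
      using norm_to_l2[OF ell2_diff[OF Te f]] f
        by (simp add: to_l2_diff Te) (simp add: T_def to_l2_of_l2)
    thus ?thesis
      using flow_tendsto[of "to_l2 f"] by (simp add: tendsto_norm_zero_iff LIM_zero_iff)
  qed
  ultimately have "C0_semigroup m T"
    by (auto simp: C0_semigroup_def T_def flow_0 flow_add of_l2_to_l2 to_l2_of_l2)
  moreover have "generator_value m T f h \<longleftrightarrow> f \<in> L_domain b c m \<and> h = (\<lambda>x. - L_op b c m f x)"
    for f h
  proof (cases "f \<in> ell2 m \<and> h \<in> ell2 m")
    case True
    have "(\<lambda>t u. to_l2 (T t (of_l2 u))) = flow" by (simp add: T_def to_l2_of_l2 fun_eq_iff)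
    thus ?thesis
      using generator_value_iff[of T f h] Te True generator_flow[of "to_l2 f" "to_l2 h"] L_iff[of f h]
      by simp
  next
    case False
    have "f \<in> ell2 m \<and> h \<in> ell2 m" if *: "f \<in> L_domain b c m \<and> h = (\<lambda>x. - L_op b c m f x)"
    proof -
      obtain w where w: "f \<in> form_domain b c m" "w \<in> ell2 m"
        "\<forall>g\<in>form_domain b c m. form_Q b c f g = ell2_inner m w g"
        using * by (auto simp: L_domain_def)
      have f: "f \<in> ell2 m" using w(1) by (simp add: form_domain_iff)
      hence "(to_l2 f, - to_l2 (\<lambda>x. - w x)) \<in> L_graph"
        using w L_graph_iff[OF f w(2)] by (simp add: to_l2_minus)
      hence "(\<lambda>x. - w x) = (\<lambda>x. - L_op b c m f x)" using L_iff[OF f ell2_minus[OF w(2)]] by simp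
      thus ?thesis using * f ell2_minus[OF w(2)] by simp
    qed
    thus ?thesis using False by (auto simp: generator_value_def)
  qed
  ultimately show ?thesis by blast
qed

text \<open>The heat semigroup transported to the unweighted space. It is known only through its
specification.\<close>

definition heat :: "real \<Rightarrow> 'v l2 \<Rightarrow> 'v l2" where
  "heat t u = to_l2 (heat_semigroup b c m t (of_l2 u))"

lemma heat_semigroup_spec:
  "C0_semigroup m (heat_semigroup b c m)"
  "generator_value m (heat_semigroup b c m) f h \<longleftrightarrow> f \<in> L_domain b c m \<and> h = (\<lambda>x. - L_op b c m f x)"
  using someI_ex[OF heat_semigroup_exists] unfolding heat_semigroup_def by blast+

lemma heat_semigroup_ell2: "0 \<le> t \<Longrightarrow> f \<in> ell2 m \<Longrightarrow> heat_semigroup b c m t f \<in> ell2 m"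
  using heat_semigroup_spec(1) by (auto simp: C0_semigroup_def bounded_operator_ell2_def)

lemma heat_semigroup_eq: "0 \<le> t \<Longrightarrow> f \<in> ell2 m \<Longrightarrow> heat_semigroup b c m t f = of_l2 (heat t (to_l2 f))"
  by (simp add: heat_def of_l2_to_l2 heat_semigroup_ell2)

lemma C0_semigroup_heat: "C0_semigroup_banach heat"
proof (rule C0_semigroup_banach.intro)
  fix t :: real assume t: "0 \<le> t"
  have "bounded_operator_ell2 m (heat_semigroup b c m t)"
    using heat_semigroup_spec(1) t by (simp add: C0_semigroup_def)
  note T = this[unfolded bounded_operator_ell2_def]
  note Te = heat_semigroup_ell2[OF t of_l2_ell2]
  obtain K where K: "\<And>f. f \<in> ell2 m \<Longrightarrow> ell2_norm m (heat_semigroup b c m t f) \<le> K * ell2_norm m f"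
    using T by (elim conjE exE) blast
  show "bounded_linear (heat t)"
  proof (rule bounded_linear_intro)
    show "heat t (u + v) = heat t u + heat t v" for u v
      using T of_l2_ell2[of u] of_l2_ell2[of v] by (simp add: heat_def of_l2_add to_l2_add Te)
    show "heat t (a *\<^sub>R u) = a *\<^sub>R heat t u" for a u
      using T of_l2_ell2[of u] by (simp add: heat_def of_l2_scale to_l2_scale Te)
    show "norm (heat t u) \<le> norm u * K" for u
      using K[OF of_l2_ell2, of u] norm_to_l2[OF of_l2_ell2, of u] norm_to_l2[OF Te, of u]
      by (simp add: heat_def to_l2_of_l2 mult.commute)
  qed
next
  note T = heat_semigroup_spec(1)[unfolded C0_semigroup_def]
  fix f
  show "heat 0 f = f" using T of_l2_ell2[of f] by (simp add: heat_def to_l2_of_l2)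
  fix s t :: real assume "0 \<le> s" "0 \<le> t"
  thus "heat (s + t) f = heat s (heat t f)" using T of_l2_ell2[of f]
    by (simp add: heat_def of_l2_to_l2 heat_semigroup_ell2)
next
  note T = heat_semigroup_spec(1)[unfolded C0_semigroup_def]
  fix f
  have "((\<lambda>t. ell2_norm m (\<lambda>x. heat_semigroup b c m t (of_l2 f) x - of_l2 f x)) \<longlongrightarrow> 0) (at_right 0)"
    using T of_l2_ell2[of f] by blast
  moreover have "ell2_norm m (\<lambda>x. heat_semigroup b c m t (of_l2 f) x - of_l2 f x) = norm (heat t f - f)"
    if "0 < t" for t
  proof -
    have "heat_semigroup b c m t (of_l2 f) \<in> ell2 m"
      using that by (simp add: heat_semigroup_ell2 of_l2_ell2)
    thus ?thesis
      using norm_to_l2[OF ell2_diff, of "heat_semigroup b c m t (of_l2 f)" "of_l2 f"] of_l2_ell2[of f]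
      by (simp add: to_l2_diff heat_def to_l2_of_l2)
  qed
  hence "\<forall>\<^sub>F t in at_right 0. ell2_norm m (\<lambda>x. heat_semigroup b c m t (of_l2 f) x - of_l2 f x) = norm (heat t f - f)"
    by (simp add: eventually_at_filter)
  ultimately have "((\<lambda>t. norm (heat t f - f)) \<longlongrightarrow> 0) (at_right 0)"
    by (rule Lim_transform_eventually)
  thus "((\<lambda>t. heat t f) \<longlongrightarrow> f) (at_right 0)"
    by (simp only: tendsto_norm_zero_iff LIM_zero_iff)
qed

lemma generator_heat: "(u, w) \<in> semigroup_generator heat \<longleftrightarrow> (u, - w) \<in> L_graph"
proof -
  have "heat = (\<lambda>t u. to_l2 (heat_semigroup b c m t (of_l2 u)))"
    by (simp add: heat_def fun_eq_iff)
  thus ?thesis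
    using generator_value_iff[OF heat_semigroup_ell2, where f = "of_l2 u" and h = "of_l2 w"]
      heat_semigroup_spec(2)[of "of_l2 u" "of_l2 w"] L_iff[OF of_l2_ell2 of_l2_ell2, of u w]
    by (simp add: to_l2_of_l2 of_l2_ell2)
qed

end

section \<open>Spheres and averaging\<close>

locale rooted_graph = lf_graph b c m
  for b :: "'v \<Rightarrow> 'v \<Rightarrow> real" and c :: "'v \<Rightarrow> real" and m :: "'v \<Rightarrow> real" +
  fixes x0 :: 'v
begin

definition level :: "'v \<Rightarrow> nat" where
  "level x = graph_dist b x x0"

lemma level_path: "(x, x0) \<in> edges b ^^ level x"
proof -
  have "(x, x0) \<in> (edges b)\<^sup>*" using connected by (simp add: graph_connected_def)
  then obtain n where "(x, x0) \<in> edges b ^^ n" by (auto simp: rtrancl_power)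
  thus ?thesis unfolding level_def graph_dist_def by (rule LeastI)
qed

lemma level_le: "(x, x0) \<in> edges b ^^ n \<Longrightarrow> level x \<le> n"
  unfolding level_def graph_dist_def by (rule Least_le)

lemma level_neighbor: "0 < b x y \<Longrightarrow> level x \<le> Suc (level y)"
proof (rule level_le)
  assume "0 < b x y"
  hence "(x, y) \<in> edges b" by (simp add: edges_def)
  hence "(x, x0) \<in> edges b O edges b ^^ level y" using level_path[of y] by blast
  thus "(x, x0) \<in> edges b ^^ Suc (level y)" by (simp add: relpow_commute)
qed

lemma level_neighbor_cases:
  assumes "0 < b x y"
  shows "level y = level x \<or> level y = Suc (level x) \<or> Suc (level y) = level x"
  using level_neighbor[OF assms] level_neighbor[of y x] assms by (auto simp: b_sym[of y x])

lemma finite_sphere: "finite {x. level x = n}"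
proof -
  have "finite {x. (x, x0) \<in> edges b ^^ n}"
  proof (induction n)
    case (Suc n)
    have "{x. (x, x0) \<in> edges b ^^ Suc n} \<subseteq> (\<Union>y\<in>{y. (y, x0) \<in> edges b ^^ n}. {x. 0 < b y x})"
    proof
      fix x assume "x \<in> {x. (x, x0) \<in> edges b ^^ Suc n}"
      hence "(x, x0) \<in> edges b O edges b ^^ n" by (simp add: relpow_commute)
      then obtain y where "0 < b x y" "(y, x0) \<in> edges b ^^ n" by (auto simp: edges_def)
      thus "x \<in> (\<Union>y\<in>{y. (y, x0) \<in> edges b ^^ n}. {x. 0 < b y x})" by (auto simp: b_sym[of x y])
    qed
    moreover have "finite (\<Union>y\<in>{y. (y, x0) \<in> edges b ^^ n}. {x. 0 < b y x})"
      using Suc finite_neighbors by blast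
    ultimately show ?case by (rule finite_subset)
  qed simp
  moreover have "{x. level x = n} \<subseteq> {x. (x, x0) \<in> edges b ^^ n}" using level_path by auto
  ultimately show ?thesis using finite_subset by blast
qed

abbreviation radial :: "('v \<Rightarrow> real) \<Rightarrow> bool" where
  "radial \<equiv> spherically_symmetric_fun b x0"

lemma radial_def: "radial f \<longleftrightarrow> (\<forall>x y. level x = level y \<longrightarrow> f x = f y)"
  by (simp add: spherically_symmetric_fun_def level_def)

lemma radial_factor:
  assumes "radial f"
  obtains F where "f = (\<lambda>x. F (level x))"
proof
  show "f = (\<lambda>x. f (SOME y. level y = level x))"
  proof
    fix x
    have "level (SOME y. level y = level x) = level x" by (rule someI) (rule refl)
    thus "f x = f (SOME y. level y = level x)" using assms unfolding radial_def by metis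
  qed
qed

abbreviation average :: "('v \<Rightarrow> real) \<Rightarrow> 'v \<Rightarrow> real" where
  "average \<equiv> averaging_op b m x0"

lemma average_eq: "average f x = (\<Sum>y | level y = level x. f y * m y) / (\<Sum>y | level y = level x. m y)"
proof -
  have "graph_sphere b x0 (int (graph_dist b x x0)) = {y. level y = level x}"
    by (auto simp: graph_sphere_def level_def)
  thus ?thesis by (simp add: averaging_op_def Let_def finite_sphere)
qed

lemma sphere_mass_pos: "0 < (\<Sum>y | level y = level x. m y)"
  by (rule sum_pos) (auto simp: finite_sphere m_pos)

lemma radial_average: "radial (average f)"
  by (simp add: radial_def average_eq)

lemma average_fin:
  assumes "f \<in> finitely_supported"
  shows "average f \<in> finitely_supported"
proof -
  have fin: "finite (\<Union>y\<in>{y. f y \<noteq> 0}. {x. level x = level y})"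
    using assms finite_sphere by (auto simp: finitely_supported_def)
  have "average f x = 0" if "x \<notin> (\<Union>y\<in>{y. f y \<noteq> 0}. {x. level x = level y})" for x
  proof -
    have "f y = 0" if "level y = level x" for y using that \<open>x \<notin> _\<close> by auto
    thus ?thesis by (simp add: average_eq)
  qed
  hence "{x. average f x \<noteq> 0} \<subseteq> (\<Union>y\<in>{y. f y \<noteq> 0}. {x. level x = level y})" by blast
  thus ?thesis unfolding finitely_supported_def using fin finite_subset by blast
qed

definition radial_l2 :: "'v l2 set" where
  "radial_l2 = {u. radial (of_l2 u)}"

lemma subspace_radial_l2: "subspace radial_l2"
  unfolding radial_l2_def
proof (rule subspaceI)
  show "0 \<in> {u. radial (of_l2 u)}" by (simp add: radial_def of_l2_zero)
  show "u + v \<in> {u. radial (of_l2 u)}"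
    if "u \<in> {u. radial (of_l2 u)}" "v \<in> {u. radial (of_l2 u)}" for u v
    using that unfolding radial_def of_l2_add mem_Collect_eq by metis
  show "a *\<^sub>R u \<in> {u. radial (of_l2 u)}" if "u \<in> {u. radial (of_l2 u)}" for a u
    using that unfolding radial_def of_l2_scale mem_Collect_eq by metis
qed

lemma closed_radial_l2: "closed radial_l2"
proof -
  have "radial_l2 = (\<Inter>x. \<Inter>y\<in>{y. level x = level y}. {u. of_l2 u x = of_l2 u y})"
    by (auto simp: radial_l2_def radial_def)
  moreover have "closed {u. of_l2 u x = of_l2 u y}" for x y
    unfolding of_l2_def divide_inverse
    by (intro closed_Collect_eq continuous_intros bounded_linear.continuous_on[OF bounded_linear_coord])
  ultimately show ?thesis by (simp only:) (intro closed_INT ballI)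
qed

lemma ex_radial_projection:
  "\<exists>A. bounded_linear A \<and> (\<forall>u. A u \<in> radial_l2)
     \<and> (\<forall>u. \<forall>v\<in>radial_l2. inner (A u) v = inner u v)"
  using orthogonal_projection_operator[OF subspace_radial_l2 closed_radial_l2] by metis

definition proj :: "'v l2 \<Rightarrow> 'v l2" where
  "proj = (SOME A. bounded_linear A \<and> (\<forall>u. A u \<in> radial_l2)
     \<and> (\<forall>u. \<forall>v\<in>radial_l2. inner (A u) v = inner u v))"

lemma bounded_linear_proj: "bounded_linear proj"
  and proj_radial: "proj u \<in> radial_l2"
  and inner_proj: "v \<in> radial_l2 \<Longrightarrow> inner (proj u) v = inner u v"
  using someI_ex[OF ex_radial_projection] unfolding proj_def[symmetric] by blast+

lemma proj_symmetric: "inner (proj u) v = inner u (proj v)"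
  using inner_proj[OF proj_radial, of u v] inner_proj[OF proj_radial, of v u]
    by (simp add: inner_commute)

text \<open>The indicator function of a sphere is itself radial, so \<open>f\<close> and its projection have the
same sum over the sphere, and the projection is constant there.\<close>

lemma average_of_l2: "average (of_l2 u) = of_l2 (proj u)"
proof
  fix x
  let ?S = "{y. level y = level x}"
  let ?e = "\<lambda>y. if level y = level x then 1 else 0 :: real"
  have e: "?e \<in> finitely_supported" by (simp add: finitely_supported_def finite_sphere)
  hence er: "to_l2 ?e \<in> radial_l2"
    by (simp add: radial_l2_def of_l2_to_l2 finsupp_ell2 radial_def)
  have ie: "inner v (to_l2 ?e) = (\<Sum>y\<in>?S. of_l2 v y * m y)" for v
  proof -
    have "inner v (to_l2 ?e) = (\<Sum>y\<in>?S. coord v y * coord (to_l2 ?e) y)"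
      by (rule inner_l2_finite) (auto simp: finite_sphere coord_to_l2 finsupp_ell2 e)
    also have "\<dots> = (\<Sum>y\<in>?S. of_l2 v y * m y)"
    proof (rule sum.cong)
      fix y assume "y \<in> ?S"
      hence "coord v y * coord (to_l2 ?e) y = coord v y * sqrt (m y)"
        by (simp add: coord_to_l2 finsupp_ell2 e)
      also have "sqrt (m y) = m y / sqrt (m y)" using m_nonneg[of y] by (simp add: real_div_sqrt)
      finally show "coord v y * coord (to_l2 ?e) y = of_l2 v y * m y" by (simp add: of_l2_def)
    qed simp
    finally show ?thesis .
  qed
  have "(\<Sum>y\<in>?S. of_l2 u y * m y) = (\<Sum>y\<in>?S. of_l2 (proj u) y * m y)"
    using inner_proj[OF er, of u] by (simp add: ie)
  also have "\<dots> = (\<Sum>y\<in>?S. of_l2 (proj u) x * m y)"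
  proof (rule sum.cong)
    fix y assume "y \<in> ?S"
    hence "of_l2 (proj u) y = of_l2 (proj u) x"
      using proj_radial[of u] unfolding radial_l2_def radial_def by blast
    thus "of_l2 (proj u) y * m y = of_l2 (proj u) x * m y" by simp
  qed simp
  finally show "average (of_l2 u) x = of_l2 (proj u) x"
    using sphere_mass_pos[of x] by (simp add: average_eq sum_distrib_left[symmetric])
qed

lemma to_l2_average: "f \<in> ell2 m \<Longrightarrow> to_l2 (average f) = proj (to_l2 f)"
  using average_of_l2[of "to_l2 f"] by (simp add: of_l2_to_l2 to_l2_of_l2)

abbreviation outer_curvature where "outer_curvature \<equiv> kappa_plus b m x0"
abbreviation inner_curvature where "inner_curvature \<equiv> kappa_minus b m x0"

lemma outer_curvature_eq: "outer_curvature x = (\<Sum>y | 0 < b x y \<and> level y = Suc (level x). b x y) / m x"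
proof -
  have "graph_sphere b x0 (int (graph_dist b x x0) + 1) = {y. level y = Suc (level x)}"
    by (auto simp: graph_sphere_def level_def)
  moreover have "(\<Sum>y | level y = Suc (level x). b x y) = (\<Sum>y | 0 < b x y \<and> level y = Suc (level x). b x y)"
    using b_nonneg[of x]
      by (intro sum.mono_neutral_right finite_sphere) (auto simp: order.order_iff_strict)
  ultimately show ?thesis by (simp add: kappa_plus_def finite_sphere)
qed

lemma inner_curvature_eq: "inner_curvature x = (\<Sum>y | 0 < b x y \<and> Suc (level y) = level x. b x y) / m x"
proof -
  have S: "graph_sphere b x0 (int (graph_dist b x x0) - 1) = {y. Suc (level y) = level x}"
    by (auto simp: graph_sphere_def level_def)
  have fin: "finite {y. Suc (level y) = level x}"
    by (rule finite_subset[OF _ finite_sphere[of "level x - 1"]]) auto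
  have "(\<Sum>y | Suc (level y) = level x. b x y) = (\<Sum>y | 0 < b x y \<and> Suc (level y) = level x. b x y)"
    using b_nonneg[of x] by (intro sum.mono_neutral_right fin) (auto simp: order.order_iff_strict)
  thus ?thesis by (simp add: kappa_minus_def S fin)
qed

text \<open>At the root, where \<open>level x - 1\<close> is truncated to \<open>0\<close>, the inner curvature vanishes, so
the formula holds there too.\<close>

lemma laplacian_radial:
  "laplacian (\<lambda>x. F (level x)) x = outer_curvature x * (F (level x) - F (Suc (level x)))
     + inner_curvature x * (F (level x) - F (level x - 1)) + c x / m x * F (level x)"
proof -
  let ?N = "{y. 0 < b x y}"
  let ?a = "F (level x) - F (Suc (level x))" and ?b = "F (level x) - F (level x - 1)"
  have "(\<Sum>y\<in>?N. b x y * (F (level x) - F (level y)))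
      = (\<Sum>y\<in>?N. (if level y = Suc (level x) then b x y else 0) * ?a + (if Suc (level y) = level x then b x y else 0) * ?b)"
  proof (rule sum.cong)
    fix y assume "y \<in> ?N"
    hence "level y = level x \<or> level y = Suc (level x) \<or> Suc (level y) = level x"
      using level_neighbor_cases by simp
    moreover have "F (level x - 1) = F (level y)" if "Suc (level y) = level x"
      by (simp add: that[symmetric])
    ultimately show "b x y * (F (level x) - F (level y))
      = (if level y = Suc (level x) then b x y else 0) * ?a + (if Suc (level y) = level x then b x y else 0) * ?b"
      by (elim disjE) simp_all
  qed simp
  also have "\<dots> = (\<Sum>y\<in>?N. if level y = Suc (level x) then b x y else 0) * ?a
      + (\<Sum>y\<in>?N. if Suc (level y) = level x then b x y else 0) * ?b"
    by (simp only: sum.distrib sum_distrib_right)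
  also have "(\<Sum>y\<in>?N. if level y = Suc (level x) then b x y else 0) = m x * outer_curvature x"
    by (simp add: outer_curvature_eq m_neq_0 finite_neighbors sum.inter_filter[symmetric] conj_commute)
  also have "(\<Sum>y\<in>?N. if Suc (level y) = level x then b x y else 0) = m x * inner_curvature x"
    by (simp add: inner_curvature_eq m_neq_0 finite_neighbors sum.inter_filter[symmetric] conj_commute)
  finally show ?thesis by (simp add: laplacian_def m_neq_0 add_divide_distrib)
qed

section \<open>Weak spherical symmetry implies commutation\<close>

lemma laplacian_radial_radial:
  assumes "radial outer_curvature" "radial inner_curvature" "radial (\<lambda>x. c x / m x)" "radial f"
  shows "radial (laplacian f)"
proof -
  obtain F where F: "f = (\<lambda>x. F (level x))" using radial_factor[OF assms(4)] .
  show ?thesis unfolding radial_def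
  proof (intro allI impI)
    fix x y assume xy: "level x = level y"
    have "outer_curvature x = outer_curvature y" "inner_curvature x = inner_curvature y" "c x / m x = c y / m y"
      using assms(1-3) xy unfolding radial_def by blast+
    thus "laplacian f x = laplacian f y" unfolding F laplacian_radial by (simp only: xy)
  qed
qed

text \<open>The fact \<open>half\<close> says that averages are orthogonal, for the form, to functions with
average zero: by Green's formula the left argument becomes the radial function
\<open>laplacian (average f)\<close>, against which \<open>g\<close> may be replaced by its average. Hence averaging is
symmetric for the form and contracts the energy, so it maps form-convergent sequences to such
sequences and these properties survive in the limit.\<close>

lemma proj_L_graph:
  assumes lapr: "\<And>f. radial f \<Longrightarrow> radial (laplacian f)" and uw: "(u, w) \<in> L_graph"
  shows "(proj u, proj w) \<in> L_graph"
proof -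
  note fin = finsupp_ell2 finsupp_energy average_fin laplacian_fin
  have half: "inner (grad (average f)) (grad g) = inner (grad (average f)) (grad (average g))"
    if f: "f \<in> finitely_supported" and g: "g \<in> finitely_supported" for f g
  proof -
    let ?h = "laplacian (average f)"
    have h: "to_l2 ?h \<in> radial_l2"
      using f by (simp add: radial_l2_def of_l2_to_l2 fin lapr radial_average)
    have "inner (grad (average f)) (grad g) = inner (to_l2 ?h) (to_l2 g)"
      using f g by (simp add: inner_grad inner_to_l2 green fin)
    also have "\<dots> = inner (to_l2 ?h) (to_l2 (average g))"
      using inner_proj[OF h, of "to_l2 g"] g by (simp add: to_l2_average fin inner_commute)
    also have "\<dots> = inner (grad (average f)) (grad (average g))"
      using f g by (simp add: inner_grad inner_to_l2 green fin)
    finally show ?thesis .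
  qed
  have sym: "inner (grad (average f)) (grad g) = inner (grad f) (grad (average g))"
    if "f \<in> finitely_supported" "g \<in> finitely_supported" for f g
    using half[OF that] half[OF that(2,1)] by (simp add: inner_commute)
  have con: "norm (grad (average f)) \<le> norm (grad f)" if f: "f \<in> finitely_supported" for f
  proof -
    have "norm (grad (average f)) * norm (grad (average f)) = inner (grad (average f)) (grad f)"
      using half[OF f f] by (simp add: dot_square_norm power2_eq_square)
    also have "\<dots> \<le> norm (grad (average f)) * norm (grad f)" by (rule norm_cauchy_schwarz)
    finally show ?thesis by (cases "norm (grad (average f)) = 0") (auto simp: mult_le_cancel_left)
  qed
  obtain k where k: "(u, k) \<in> closed_grad" "\<And>v l. (v, l) \<in> grad_graph \<Longrightarrow> inner k l = inner w v"
    using uw by (elim L_graphE) blast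
  obtain p where p: "\<And>n. p n \<in> finitely_supported" "(\<lambda>n. to_l2 (p n)) \<longlonglongrightarrow> u" "(\<lambda>n. grad (p n)) \<longlonglongrightarrow> k"
    using closed_grad_sequence[OF k(1)] by blast
  have diff: "grad (average (p i)) - grad (average (p j)) = grad (average (\<lambda>x. p i x - p j x))"
    for i j
  proof -
    have "average (\<lambda>x. p i x - p j x) = (\<lambda>x. average (p i) x - average (p j) x)"
      by (auto simp: average_eq left_diff_distrib sum_subtractf diff_divide_distrib)
    thus ?thesis by (simp add: grad_diff fin p(1))
  qed
  have "Cauchy (\<lambda>n. grad (average (p n)))"
  proof (rule metric_CauchyI)
    fix e :: real assume "e > 0"
    then obtain N where N: "\<And>i j. i \<ge> N \<Longrightarrow> j \<ge> N \<Longrightarrow> dist (grad (p i)) (grad (p j)) < e"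
      using metric_CauchyD[OF LIMSEQ_imp_Cauchy[OF p(3)]] by blast
    have "dist (grad (average (p i))) (grad (average (p j))) < e" if "i \<ge> N" "j \<ge> N" for i j
    proof -
      have "norm (grad (average (\<lambda>x. p i x - p j x))) \<le> norm (grad (\<lambda>x. p i x - p j x))"
        by (rule con[OF finsupp_diff[OF p(1) p(1)]])
      thus ?thesis using N[OF that] by (simp add: dist_norm diff grad_diff fin p(1))
    qed
    thus "\<exists>M. \<forall>m\<ge>M. \<forall>n\<ge>M. dist (grad (average (p m))) (grad (average (p n))) < e" by blast
  qed
  then obtain k' where k': "(\<lambda>n. grad (average (p n))) \<longlonglongrightarrow> k'"
    using Cauchy_convergent_iff convergent_def by blast
  have "(\<lambda>n. to_l2 (average (p n))) \<longlonglongrightarrow> proj u"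
    using bounded_linear.tendsto[OF bounded_linear_proj p(2)]
      by (simp add: to_l2_average fin p(1))
  hence "(\<lambda>n. (to_l2 (average (p n)), grad (average (p n)))) \<longlonglongrightarrow> (proj u, k')"
    using k' by (rule tendsto_Pair)
  hence "(proj u, k') \<in> closed_grad" unfolding closure_sequential
    using grad_graphI[OF average_fin[OF p(1)]]
    by (intro exI[of _ "\<lambda>n. (to_l2 (average (p n)), grad (average (p n)))"]) simp
  moreover have "inner k' l = inner (proj w) v" if vl: "(v, l) \<in> grad_graph" for v l
  proof -
    obtain g where g: "g \<in> finitely_supported" "v = to_l2 g" "l = grad g"
      using vl by (auto simp: grad_graph_def)
    have "(\<lambda>n. inner (grad (average (p n))) (grad g)) \<longlonglongrightarrow> inner k' (grad g)"
      by (intro tendsto_intros k')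
    moreover have "(\<lambda>n. inner (grad (p n)) (grad (average g))) \<longlonglongrightarrow> inner k (grad (average g))"
      by (intro tendsto_intros p)
    ultimately have "inner k' (grad g) = inner k (grad (average g))"
      by (simp add: sym p(1) g(1) LIMSEQ_unique)
    also have "\<dots> = inner w (to_l2 (average g))" by (rule k(2)[OF grad_graphI[OF average_fin[OF g(1)]]])
    also have "\<dots> = inner (proj w) (to_l2 g)" by (simp add: to_l2_average fin g(1) proj_symmetric)
    finally show ?thesis by (simp add: g)
  qed
  ultimately show ?thesis by (rule L_graphI)
qed

lemma weak_imp_heat:
  assumes "radial outer_curvature" "radial inner_curvature" "radial (\<lambda>x. c x / m x)" and t: "0 \<le> t" and f: "f \<in> ell2 m"
  shows "average (heat_semigroup b c m t f) = heat_semigroup b c m t (average f)"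
proof -
  have "proj (heat t (to_l2 f)) = heat t (proj (to_l2 f))"
    using semigroup_commute[OF C0_semigroup_heat generator_heat bounded_linear_proj proj_L_graph t]
      laplacian_radial_radial[OF assms(1-3)] by blast
  moreover have "average f = of_l2 (proj (to_l2 f))"
    using average_of_l2[of "to_l2 f"] f by (simp add: of_l2_to_l2)
  ultimately show ?thesis
    using t f by (simp add: heat_semigroup_eq average_of_l2 to_l2_of_l2 of_l2_ell2)
qed

section \<open>Commutation implies weak spherical symmetry\<close>

text \<open>Finitely supported functions lie in the domain of \<open>L\<close>, which acts on them as the formal
Laplacian, and convergence in norm implies convergence at each vertex.\<close>

lemma heat_deriv_pointwise:
  assumes f: "f \<in> finitely_supported"
  shows "((\<lambda>t. (heat_semigroup b c m t f x - f x) / t) \<longlongrightarrow> - laplacian f x) (at_right 0)"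
proof -
  have "(to_l2 f, - to_l2 (laplacian f)) \<in> semigroup_generator heat"
    using finsupp_L_graph[OF f] by (simp add: generator_heat)
  hence "((\<lambda>t. (heat t (to_l2 f) - to_l2 f) /\<^sub>R t) \<longlongrightarrow> - to_l2 (laplacian f)) (at_right 0)"
    by (simp add: semigroup_generator_def)
  from tendsto_of_l2[OF this, of x]
  have "((\<lambda>t. of_l2 ((heat t (to_l2 f) - to_l2 f) /\<^sub>R t) x) \<longlongrightarrow> - laplacian f x) (at_right 0)"
    by (simp add: of_l2_minus of_l2_to_l2 finsupp_ell2 laplacian_fin f)
  moreover have "of_l2 ((heat t (to_l2 f) - to_l2 f) /\<^sub>R t) x = (heat_semigroup b c m t f x - f x) / t"
    if "0 < t" for t
    using that f
      by (simp add: of_l2_scale of_l2_diff of_l2_to_l2 heat_semigroup_eq finsupp_ell2 divide_inverse mult.commute)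
  hence "\<forall>\<^sub>F t in at_right 0. of_l2 ((heat t (to_l2 f) - to_l2 f) /\<^sub>R t) x = (heat_semigroup b c m t f x - f x) / t"
    by (simp add: eventually_at_filter)
  ultimately show ?thesis by (rule Lim_transform_eventually)
qed

text \<open>Averages are finite sums, so the pointwise derivatives at time \<open>0\<close> can be averaged.\<close>

lemma laplacian_average:
  assumes comm: "\<And>t f. 0 \<le> t \<Longrightarrow> f \<in> ell2 m \<Longrightarrow>
      average (heat_semigroup b c m t f) = heat_semigroup b c m t (average f)"
    and f: "f \<in> finitely_supported"
  shows "laplacian (average f) x = average (laplacian f) x"
proof -
  let ?q = "\<lambda>t y. (heat_semigroup b c m t f y - f y) / t"
  have "((\<lambda>t. average (?q t) x) \<longlongrightarrow> average (\<lambda>y. - laplacian f y) x) (at_right 0)"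
    unfolding average_eq using sphere_mass_pos[of x]
    by (intro tendsto_intros heat_deriv_pointwise f) auto
  moreover have "average (?q t) x = (heat_semigroup b c m t (average f) x - average f x) / t"
    if "0 < t" for t
  proof -
    have "average (?q t) x = (average (heat_semigroup b c m t f) x - average f x) / t"
    proof -
      have "(\<Sum>y | level y = level x. ?q t y * m y) = (\<Sum>y | level y = level x. heat_semigroup b c m t f y * m y - f y * m y) / t"
        unfolding sum_divide_distrib by (rule sum.cong) (simp_all add: left_diff_distrib)
      thus ?thesis by (simp add: average_eq sum_subtractf diff_divide_distrib mult.commute)
    qed
    thus ?thesis using comm[of t f] that f by (simp add: finsupp_ell2)
  qed
  hence "\<forall>\<^sub>F t in at_right 0. average (?q t) x = (heat_semigroup b c m t (average f) x - average f x) / t"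
    by (simp add: eventually_at_filter)
  ultimately have "((\<lambda>t. (heat_semigroup b c m t (average f) x - average f x) / t)
      \<longlongrightarrow> average (\<lambda>y. - laplacian f y) x) (at_right 0)" by (rule Lim_transform_eventually)
  hence "- laplacian (average f) x = average (\<lambda>y. - laplacian f y) x"
    using heat_deriv_pointwise[OF average_fin[OF f]]
      by (rule tendsto_unique[OF trivial_limit_at_right_real, rotated])
  thus ?thesis by (simp add: average_eq sum_negf)
qed

text \<open>With \<open>M\<close> the mass of the sphere and \<open>z\<close> one of its vertices, the indicator function is the
average of the function with value \<open>M / m z\<close> at \<open>z\<close> and \<open>0\<close> elsewhere. So its Laplacian is
itself an average, hence radial.\<close>

lemma laplacian_sphere_radial:
  assumes comm: "\<And>t f. 0 \<le> t \<Longrightarrow> f \<in> ell2 m \<Longrightarrow>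
      average (heat_semigroup b c m t f) = heat_semigroup b c m t (average f)"
  shows "radial (laplacian (\<lambda>x. if level x = n then 1 else 0))"
proof (cases "\<exists>z. level z = n")
  case False
  hence "(\<lambda>x. if level x = n then 1 else 0) = (\<lambda>x. 0 :: real)" by auto
  thus ?thesis by (simp add: laplacian_def radial_def)
next
  case True
  then obtain z where z: "level z = n" by blast
  define M where "M = (\<Sum>y | level y = n. m y)"
  have M: "M > 0" using sphere_mass_pos[of z] by (simp add: M_def z)
  let ?f = "\<lambda>y. if y = z then M / m z else 0"
  have f: "?f \<in> finitely_supported" by (simp add: finitely_supported_def)
  have "average ?f = (\<lambda>x. if level x = n then 1 else 0)"
  proof
    fix x
    have "(\<Sum>y | level y = level x. ?f y * m y) = (\<Sum>y | level y = level x. if y = z then M else 0)"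
      by (rule sum.cong) (auto simp: m_neq_0)
    thus "average ?f x = (if level x = n then 1 else 0)"
      using M z by (auto simp: average_eq finite_sphere M_def)
  qed
  hence "laplacian (\<lambda>x. if level x = n then 1 else 0) = average (laplacian ?f)"
    using laplacian_average[OF comm f] by auto
  thus ?thesis using radial_average by simp
qed

text \<open>At a vertex of level \<open>r\<close> the indicator functions of the spheres of radius \<open>r + 1\<close>,
\<open>r - 1\<close> and \<open>r\<close> give, up to sign, the outer curvature, the inner curvature, and the sum of
both curvatures and \<open>q\<close>.\<close>

lemma heat_imp_weak:
  assumes comm: "\<And>t f. 0 \<le> t \<Longrightarrow> f \<in> ell2 m \<Longrightarrow>
      average (heat_semigroup b c m t f) = heat_semigroup b c m t (average f)"
  shows "radial outer_curvature \<and> radial inner_curvature \<and> radial (\<lambda>x. c x / m x)"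
proof -
  have "outer_curvature x = outer_curvature y \<and> inner_curvature x = inner_curvature y
      \<and> c x / m x = c y / m y" if xy: "level x = level y" for x y
  proof -
    have eq: "laplacian (\<lambda>x. if level x = n then 1 else 0) x = laplacian (\<lambda>x. if level x = n then 1 else 0) y"
      for n
      using laplacian_sphere_radial[OF comm] xy unfolding radial_def by blast
    note formula = laplacian_radial[of "\<lambda>r. if r = n then 1 else 0" for n]
    have outer_curvature: "outer_curvature x = outer_curvature y"
    proof -
      have "level y - Suc 0 \<noteq> Suc (level y)" by simp
      thus ?thesis using eq[of "Suc (level x)"] by (simp add: formula xy)
    qed
    have inner_curvature: "inner_curvature x = inner_curvature y"
    proof (cases "level x")
      case 0
      thus ?thesis using xy by (simp add: inner_curvature_eq)
    next
      case (Suc r)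
      thus ?thesis using eq[of r] xy by (simp add: formula)
    qed
    have "c x / m x = c y / m y"
    proof (cases "level x")
      case 0
      thus ?thesis using eq[of 0] outer_curvature xy by (simp add: formula)
    next
      case (Suc r)
      thus ?thesis
        using eq[of "level x"] outer_curvature inner_curvature xy by (simp add: formula)
    qed
    thus ?thesis using outer_curvature inner_curvature by blast
  qed
  thus ?thesis unfolding radial_def by blast
qed

end

theorem theorem1:
  fixes b :: "'v \<Rightarrow> 'v \<Rightarrow> real" and c :: "'v \<Rightarrow> real" and m :: "'v \<Rightarrow> real"
  assumes "weighted_graph b c m"
    and "graph_connected b"
    and "locally_finite_graph b"
  shows "weakly_spherically_symmetric b c m \<longleftrightarrow> heat_kernel_spherically_symmetric b c m"
proof -
  have rg: "rooted_graph b c m"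
    using assms by (simp add: rooted_graph_def lf_graph_def lf_graph_axioms_def)
  show ?thesis
    unfolding weakly_spherically_symmetric_def heat_kernel_spherically_symmetric_def
  proof (rule iff_exI)
    fix x0 :: 'v
    interpret rooted_graph b c m x0 by (rule rg)
    show "(radial (kappa_plus b m x0) \<and> radial (kappa_minus b m x0) \<and> radial (\<lambda>x. c x / m x))
      \<longleftrightarrow> (\<forall>t\<ge>0. \<forall>f\<in>ell2 m. average (heat_semigroup b c m t f) = heat_semigroup b c m t (average f))"
      using weak_imp_heat heat_imp_weak by blast
  qed
qed

end
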